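(* Let $L\subset\mathbb C$ be a lattice of rank two without complex multiplication, and let $n$, $m$ be distinct primes. Then for any lattice $L'$ satisfying $L\subsetneq L'\subsetneq L/n$, the rational functions $A_{m,L'}$ and $A_{m,L}$ are mutually semiconjugate but $A_{m,L'}\not\sim A_{m,L}$.
   Context: For a lattice $L$ of rank two in $\mathbb C$, $\wp_L$ denotes the Weierstrass $\wp$-function with period lattice $L$, and $L/n=\{\lambda/n:\lambda\in L\}$. For an integer $m\ge 2$, $A_{m,L}$ denotes the rational function determined by $\wp_L(mz)=A_{m,L}(\wp_L(z))$. A lattice $L$ has complex multiplication if there exists $a\in\mathbb C\setminus\mathbb Z$ with $aL\subseteq L$; otherwise it is without complex multiplication. Semiconjugacy: a rational function $B$ is semiconjugate to a rational function $A$ if there exists a non-constant rational function $X$ such that $A\circ X=X\circ B$. $A$ and $B$ are mutually semiconjugate if $A$ is semiconjugate to $B$ and $B$ is semiconjugate to $A$. Equivalence $\sim$: if $A=U\circ V$ is a decomposition of a rational function $A$ into a composition of rational functions (factors of degree one are allowed), then $V\circ U$ is called an elementary transformation of $A$. We write $A\sim B$ ($A$ and $B$ are equivalent) if there is a finite chain of elementary transformations between $A$ and $B$. *)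

theory Defs
  imports "HOL-Analysis.Analysis" "HOL-Computational_Algebra.Computational_Algebra"
    "HOL-Computational_Algebra.Field_as_Ring"
begin

section \<open>Rational functions over the complex numbers\<close>

type_synonym ratfun = "complex poly fract"

definition rat_const :: "complex \<Rightarrow> ratfun" where
  "rat_const c = to_fract [:c:]"

text \<open>The representation \<open>(num A, denom A)\<close> is in lowest terms.\<close>

definition num :: "ratfun \<Rightarrow> complex poly" where
  "num A = fst (quot_of_fract A)"

definition denom :: "ratfun \<Rightarrow> complex poly" where
  "denom A = snd (quot_of_fract A)"

definition nonconstant :: "ratfun \<Rightarrow> bool" where
  "nonconstant A \<longleftrightarrow> A \<notin> range rat_const"

text \<open>
  The composition \<open>A \<circ> X\<close>: the element \<open>X\<close> of the field of rational functions is substituted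
  into \<open>A\<close>. For nonconstant \<open>X\<close> the denominator below is nonzero, as \<open>X\<close> is transcendental
  over the constants. If \<open>X\<close> is a constant that is a pole of \<open>A\<close> then the value is \<open>0\<close> rather
  than infinity; this affects only the relations below between constant functions.
\<close>

definition rat_comp :: "ratfun \<Rightarrow> ratfun \<Rightarrow> ratfun" where
  "rat_comp A X = poly (map_poly rat_const (num A)) X / poly (map_poly rat_const (denom A)) X"

definition semiconjugate_to :: "ratfun \<Rightarrow> ratfun \<Rightarrow> bool" where
  "semiconjugate_to B A \<longleftrightarrow> (\<exists>X. nonconstant X \<and> rat_comp A X = rat_comp X B)"

definition mutually_semiconjugate :: "ratfun \<Rightarrow> ratfun \<Rightarrow> bool" where
  "mutually_semiconjugate A B \<longleftrightarrow> semiconjugate_to A B \<and> semiconjugate_to B A"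

definition elementary_transformation :: "ratfun \<Rightarrow> ratfun \<Rightarrow> bool" where
  "elementary_transformation A B \<longleftrightarrow> (\<exists>U V. A = rat_comp U V \<and> B = rat_comp V U)"

text \<open>
  Elementary transformations form a symmetric relation, so the chains below need not be
  allowed to go backwards explicitly.
\<close>

definition rat_equiv :: "ratfun \<Rightarrow> ratfun \<Rightarrow> bool" where
  "rat_equiv = elementary_transformation\<^sup>*\<^sup>*"

section \<open>Lattices and the Weierstrass function\<close>

text \<open>Here \<open>independent\<close> is linear independence over the reals.\<close>

definition lattice2 :: "complex set \<Rightarrow> bool" where
  "lattice2 L \<longleftrightarrow> (\<exists>\<omega>1 \<omega>2. \<omega>1 \<noteq> \<omega>2 \<and> independent {\<omega>1, \<omega>2} \<and>
     L = {of_int a * \<omega>1 + of_int b * \<omega>2 | a b. True})"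

definition has_CM :: "complex set \<Rightarrow> bool" where
  "has_CM L \<longleftrightarrow> (\<exists>a. a \<notin> \<int> \<and> (*) a ` L \<subseteq> L)"

definition lattice_div :: "complex set \<Rightarrow> nat \<Rightarrow> complex set" where
  "lattice_div L n = (\<lambda>l. l / of_nat n) ` L"

text \<open>
  The sum converges absolutely. At the poles \<open>z \<in> L\<close> the value is meaningless
  and is never used.
\<close>

definition wp :: "complex set \<Rightarrow> complex \<Rightarrow> complex" where
  "wp L z = 1 / z ^ 2 + (\<Sum>\<^sub>\<infinity>l\<in>L - {0}. 1 / (z - l) ^ 2 - 1 / l ^ 2)"

text \<open>
  The identity \<open>\<wp>(mz) = A(\<wp>(z))\<close> is required wherever its left-hand side is finite; if
  \<open>m z \<notin> L\<close> then also \<open>z \<notin> L\<close>.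
\<close>

definition mult_ratfun :: "nat \<Rightarrow> complex set \<Rightarrow> ratfun" where
  "mult_ratfun m L = (THE A. \<forall>z. of_nat m * z \<notin> L \<longrightarrow>
     poly (denom A) (wp L z) \<noteq> 0 \<and>
     wp L (of_nat m * z) = poly (num A) (wp L z) / poly (denom A) (wp L z))"

end

theory Submission
  imports Defs "HOL-Complex_Analysis.Complex_Analysis"
begin

text \<open>
  The function \<open>\<wp>\<^bsub>L\<^esub>\<close> identifies the quotient of the plane by \<open>L\<close> and by \<open>z \<mapsto> -z\<close> with the
  Riemann sphere, and \<open>A\<^bsub>m,L\<^esub>\<close> is multiplication by \<open>m\<close> read in this coordinate.

  Semiconjugacy. Multiplication by \<open>n\<close> carries \<open>L'\<close> into \<open>L\<close>, and the identity carries \<open>L\<close> into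
  \<open>L'\<close>. Both commute with multiplication by \<open>m\<close> and with \<open>z \<mapsto> -z\<close>, so on the sphere they become
  rational functions that intertwine \<open>A\<^bsub>m,L'\<^esub>\<close> and \<open>A\<^bsub>m,L\<^esub>\<close> (lemma \<open>semiconjugate_if_isogenous\<close>).

  Non-equivalence. Say that \<open>(g, M)\<close> uniformizes \<open>B\<close> if \<open>g\<close> is an even meromorphic function on the
  plane with \<open>g(mz) = B(g(z))\<close> whose general fibre is \<open>(z + M) \<union> (-z + M)\<close>. If \<open>B = U \<circ> V\<close> then
  \<open>V \<circ> g\<close> uniformizes \<open>V \<circ> U\<close>, and since \<open>U \<circ> (V \<circ> g)\<close> is \<open>g(m z)\<close>, its group of periods lies
  between \<open>M\<close> and \<open>M/m\<close> (lemma \<open>elementary_step\<close>). Hence, if \<open>A\<^bsub>m,L'\<^esub>\<close> and \<open>A\<^bsub>m,L\<^esub>\<close> were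
  equivalent, \<open>A\<^bsub>m,L\<^esub>\<close> would be uniformized by some \<open>(g, M)\<close> with \<open>L' \<subseteq> M\<close> and with each element
  of \<open>M\<close> carried into \<open>L'\<close> by a power of \<open>m\<close>.

  On the other hand the uniformization of \<open>A\<^bsub>m,L\<^esub>\<close> is unique up to a homothety (lemma
  \<open>homothetic\<close>). The point \<open>g(0)\<close> is fixed by \<open>A\<^bsub>m,L\<^esub>\<close>; write it as \<open>\<wp>\<^bsub>L\<^esub>(w)\<close>. Near \<open>0\<close> one can lift
  \<open>g\<close> through \<open>\<wp>\<^bsub>L\<^esub>\<close> at \<open>w\<close>, after passing to the coordinate \<open>z\<^sup>2\<close> if \<open>2w \<in> L\<close>, and the lift commutes
  with an expanding multiplication up to sign. Comparing Taylor coefficients, it is linear. So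
  \<open>g(z) = \<wp>\<^bsub>L\<^esub>(w + az)\<close>, and \<open>M = {t. a t \<in> L}\<close>.

  Then \<open>aL \<subseteq> L\<close>, so \<open>a\<close> is an integer \<open>k\<close> because \<open>L\<close> has no complex multiplication. If \<open>n\<close> does
  not divide \<open>k\<close>, then \<open>nL' \<subseteq> L\<close> and \<open>kL' \<subseteq> L\<close> give \<open>L' \<subseteq> L\<close>. If \<open>n\<close> divides \<open>k\<close>, then
  \<open>L/n \<subseteq> M\<close>, so an element of \<open>L/n\<close> is carried into \<open>L'\<close> both by \<open>n\<close> and by a power of \<open>m\<close>, hence
  lies in \<open>L'\<close>. Both conclusions contradict \<open>L \<subset> L' \<subset> L/n\<close>.

  The facts about \<open>\<wp>\<close> that this needs are obtained from Liouville's theorem alone, with no contour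
  integration. The function \<open>\<wp>'' - 6\<wp>\<^sup>2\<close> is constant. So the values \<open>\<wp>(a)\<close> and \<open>\<wp>'(a)\<close> determine
  all Taylor coefficients at \<open>a\<close>, while \<open>\<wp>(a)\<close> determines \<open>\<wp>'(a)\<close> up to sign. This gives the fibres
  of \<open>\<wp>\<close> (theorem \<open>wp_eq_iff\<close>). For a lattice \<open>M\<close> containing \<open>L\<close>, clearing the poles of \<open>\<wp>\<^bsub>M\<^esub>\<close>
  outside \<open>L\<close> leaves a polynomial in \<open>\<wp>\<^bsub>L\<^esub>\<close> (theorem \<open>wp_superlattice_rational\<close>).
\<close>

section \<open>Evaluation of rational functions\<close>

text \<open>
  At a pole the value is \<open>0\<close>. This adds finitely many points to the fibre over \<open>0\<close>.
\<close>

definition rat_eval :: "ratfun \<Rightarrow> complex \<Rightarrow> complex" where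
  "rat_eval A x = poly (num A) x / poly (denom A) x"

lemma denom_nonzero: "denom A \<noteq> 0"
  by (simp add: denom_def)

lemma Fract_num_denom: "Fract (num A) (denom A) = A"
  by (simp add: num_def denom_def)

lemma coprime_num_denom: "coprime (num A) (denom A)"
  by (simp add: num_def denom_def coprime_quot_of_fract)

lemma denom_Fract_dvd:
  assumes "q \<noteq> 0"
  shows "denom (Fract p q) dvd q"
proof -
  let ?A = "Fract p q"
  have "Fract (num ?A) (denom ?A) = Fract p q"
    by (rule Fract_num_denom)
  then have "num ?A * q = p * denom ?A"
    using assms denom_nonzero by (simp add: eq_fract)
  then have "denom ?A dvd q * num ?A"
    by (simp add: mult.commute[of q])
  then show ?thesis
    using coprime_num_denom[of ?A] by (simp add: coprime_commute coprime_dvd_mult_left_iff)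
qed

lemma rat_eval_Fract:
  assumes "q \<noteq> 0" "poly q x \<noteq> 0"
  shows "poly (denom (Fract p q)) x \<noteq> 0" "rat_eval (Fract p q) x = poly p x / poly q x"
proof -
  let ?A = "Fract p q"
  show d: "poly (denom ?A) x \<noteq> 0"
    using denom_Fract_dvd[OF assms(1), of p] assms(2) by (metis dvdE mult_eq_0_iff poly_mult)
  have "Fract (num ?A) (denom ?A) = Fract p q"
    by (rule Fract_num_denom)
  then have "num ?A * q = p * denom ?A"
    using assms denom_nonzero by (simp add: eq_fract)
  then have "poly (num ?A) x * poly q x = poly p x * poly (denom ?A) x"
    by (metis poly_mult)
  then show "rat_eval ?A x = poly p x / poly q x"
    using assms d by (simp add: rat_eval_def field_simps)
qed

lemma rat_eval_add:
  assumes "poly (denom A) x \<noteq> 0" "poly (denom B) x \<noteq> 0"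
  shows "poly (denom (A + B)) x \<noteq> 0" "rat_eval (A + B) x = rat_eval A x + rat_eval B x"
proof -
  have *: "A + B = Fract (num A * denom B + num B * denom A) (denom A * denom B)"
    using add_fract[OF denom_nonzero[of A] denom_nonzero[of B], of "num A" "num B"]
    by (simp only: Fract_num_denom)
  have **: "denom A * denom B \<noteq> 0" "poly (denom A * denom B) x \<noteq> 0"
    using assms denom_nonzero by auto
  show "poly (denom (A + B)) x \<noteq> 0" "rat_eval (A + B) x = rat_eval A x + rat_eval B x"
    unfolding * rat_eval_Fract(2)[OF **] using assms rat_eval_Fract(1)[OF **]
    by (simp_all add: rat_eval_def add_frac_eq)
qed

lemma rat_eval_mult:
  assumes "poly (denom A) x \<noteq> 0" "poly (denom B) x \<noteq> 0"
  shows "poly (denom (A * B)) x \<noteq> 0" "rat_eval (A * B) x = rat_eval A x * rat_eval B x"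
proof -
  have *: "A * B = Fract (num A * num B) (denom A * denom B)"
    using mult_fract[of "num A" "denom A" "num B" "denom B"] by (simp only: Fract_num_denom)
  have **: "denom A * denom B \<noteq> 0" "poly (denom A * denom B) x \<noteq> 0"
    using assms denom_nonzero by auto
  show "poly (denom (A * B)) x \<noteq> 0" "rat_eval (A * B) x = rat_eval A x * rat_eval B x"
    unfolding * rat_eval_Fract(2)[OF **] using assms rat_eval_Fract(1)[OF **]
    by (simp_all add: rat_eval_def)
qed

lemma rat_eval_divide:
  assumes "poly (denom A) x \<noteq> 0" "poly (denom B) x \<noteq> 0" "rat_eval B x \<noteq> 0"
  shows "rat_eval (A / B) x = rat_eval A x / rat_eval B x"
proof -
  have *: "A / B = Fract (num A * denom B) (denom A * num B)"
    using divide_fract[of "num A" "denom A" "num B" "denom B"] by (simp only: Fract_num_denom)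
  have **: "denom A * num B \<noteq> 0" "poly (denom A * num B) x \<noteq> 0"
    using assms denom_nonzero by (auto simp: rat_eval_def)
  show "rat_eval (A / B) x = rat_eval A x / rat_eval B x"
    unfolding * rat_eval_Fract(2)[OF **] using assms rat_eval_Fract(1)[OF **]
    by (simp_all add: rat_eval_def)
qed

lemma rat_eval_const: "poly (denom (rat_const c)) x \<noteq> 0" "rat_eval (rat_const c) x = c"
  using rat_eval_Fract[of 1 x "[:c:]"] by (simp_all add: rat_const_def to_fract_def)

lemma rat_const_0: "rat_const 0 = 0"
  and rat_const_add: "rat_const (a + b) = rat_const a + rat_const b"
  and rat_const_mult: "rat_const (a * b) = rat_const a * rat_const b"
  by (simp_all add: rat_const_def to_fract_def Zero_fract_def mult.commute)

lemma rat_eval_poly: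
  assumes "poly (denom X) x \<noteq> 0"
  shows "poly (denom (poly (map_poly rat_const p) X)) x \<noteq> 0 \<and>
         rat_eval (poly (map_poly rat_const p) X) x = poly p (rat_eval X x)"
proof (induction p)
  case 0
  then show ?case
    using rat_eval_const[of 0 x] by (simp add: rat_const_0)
next
  case (pCons c p)
  have "map_poly rat_const (pCons c p) = pCons (rat_const c) (map_poly rat_const p)"
    by (rule map_poly_pCons) (rule rat_const_0)
  moreover have m: "poly (denom (X * poly (map_poly rat_const p) X)) x \<noteq> 0"
    "rat_eval (X * poly (map_poly rat_const p) X) x = rat_eval X x * poly p (rat_eval X x)"
    using rat_eval_mult[OF assms conjunct1[OF pCons.IH]] pCons.IH by auto
  ultimately show ?case
    using rat_eval_add[OF rat_eval_const(1)[of c x] m(1)] rat_eval_const(2)[of c x] m(2) by auto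
qed

lemma rat_eval_eqI:
  assumes "infinite {x. rat_eval A x = rat_eval B x}"
  shows "A = B"
proof -
  let ?p = "num A * denom B - num B * denom A"
  have cross: "poly ?p x = 0"
    if "rat_eval A x = rat_eval B x" "poly (denom A) x \<noteq> 0" "poly (denom B) x \<noteq> 0" for x
    using that by (simp add: rat_eval_def frac_eq_eq)
  have "{x. rat_eval A x = rat_eval B x} \<subseteq> {x. poly ?p x = 0} \<union> {x. poly (denom A * denom B) x = 0}"
    using cross by auto
  moreover have "finite {x. poly (denom A * denom B) x = 0}"
    using denom_nonzero by (intro poly_roots_finite) simp
  ultimately have "infinite {x. poly ?p x = 0}"
    using assms by (metis finite_UnI finite_subset)
  then have "?p = 0"
    using poly_roots_finite by blast
  then have "Fract (num A) (denom A) = Fract (num B) (denom B)"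
    using denom_nonzero by (simp add: eq_fract)
  then show ?thesis
    by (simp add: Fract_num_denom)
qed

lemma rat_eval_finite_fibre:
  assumes "nonconstant A"
  shows "finite {x. rat_eval A x = c}"
proof (rule ccontr)
  assume "infinite {x. rat_eval A x = c}"
  then have "A = rat_const c"
    by (intro rat_eval_eqI) (simp add: rat_eval_const)
  then show False
    using assms by (simp add: nonconstant_def)
qed

lemma finite_rat_eval_vimage:
  assumes "nonconstant A" "finite S"
  shows "finite {x. rat_eval A x \<in> S}"
proof -
  have "{x. rat_eval A x \<in> S} = (\<Union>c\<in>S. {x. rat_eval A x = c})"
    by auto
  then show ?thesis
    using assms rat_eval_finite_fibre by auto
qed

text \<open>
  Substitution into numerator and denominator is compatible with evaluation away from the poles of
  \<open>X\<close> and the points that \<open>X\<close> sends to poles of \<open>A\<close>. There are finitely many of the latter because a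
  nonconstant rational function has finite fibres.
\<close>

lemma rat_eval_comp:
  assumes "nonconstant X"
  shows "finite {x. rat_eval (rat_comp A X) x \<noteq> rat_eval A (rat_eval X x)}"
proof -
  let ?S = "{x. poly (denom X) x = 0} \<union> {x. rat_eval X x \<in> {y. poly (denom A) y = 0}}"
  have "{x. rat_eval (rat_comp A X) x \<noteq> rat_eval A (rat_eval X x)} \<subseteq> ?S"
  proof (rule ccontr)
    assume "\<not> ?thesis"
    then obtain x where x: "rat_eval (rat_comp A X) x \<noteq> rat_eval A (rat_eval X x)"
      "poly (denom X) x \<noteq> 0" "poly (denom A) (rat_eval X x) \<noteq> 0"
      by auto
    then show False
      using rat_eval_divide[of "poly (map_poly rat_const (num A)) X" x "poly (map_poly rat_const (denom A)) X"]
        rat_eval_poly[OF x(2)] by (auto simp: rat_comp_def rat_eval_def[of A])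
  qed
  moreover have "finite ?S"
    using poly_roots_finite[OF denom_nonzero] finite_rat_eval_vimage[OF assms, of "{y. poly (denom A) y = 0}"]
    by simp
  ultimately show ?thesis
    using finite_subset by blast
qed

lemma poly_map_rat_const: "poly (map_poly rat_const p) (rat_const c) = rat_const (poly p c)"
proof (induction p)
  case (pCons a p)
  have "map_poly rat_const (pCons a p) = pCons (rat_const a) (map_poly rat_const p)"
    by (rule map_poly_pCons) (rule rat_const_0)
  with pCons show ?case
    by (simp add: rat_const_add rat_const_mult)
qed (simp add: rat_const_0)

lemma rat_comp_const: "rat_comp A (rat_const c) \<in> range rat_const"
proof -
  have "rat_const a / rat_const b = rat_const (a / b)" for a b
  proof (cases "b = 0")
    case False
    then have "rat_const b \<noteq> 0"
      by (simp add: rat_const_def)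
    moreover have "rat_const a = rat_const (a / b) * rat_const b"
      using False by (simp flip: rat_const_mult)
    ultimately show ?thesis
      by (rule divide_eq_imp)
  qed (simp add: rat_const_0)
  then show ?thesis
    by (simp add: rat_comp_def poly_map_rat_const)
qed

lemma const_rat_comp: "rat_comp (rat_const c) X = rat_const c"
proof -
  have "num (rat_const c) = [:c:]" "denom (rat_const c) = 1"
    by (simp_all add: num_def denom_def rat_const_def)
  moreover have "map_poly rat_const 1 = 1"
    by (simp add: one_pCons map_poly_pCons rat_const_0) (simp add: rat_const_def one_pCons[symmetric])
  ultimately show ?thesis
    by (simp add: rat_comp_def map_poly_pCons rat_const_0)
qed

lemma nonconstant_rat_comp:
  assumes "nonconstant (rat_comp A B)"
  shows "nonconstant A" "nonconstant B"
  using assms rat_comp_const const_rat_comp unfolding nonconstant_def by blast+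

section \<open>Properties that hold outside a countable set\<close>

text \<open>
  The notion of a general point used throughout. Exceptional sets have to be collected over all
  elements of a lattice, so finite or discrete sets would not do. Countable sets are closed under
  such unions, and still a nonempty open set always contains a general point.
\<close>

definition cocountable :: "complex filter" where
  "cocountable = Abs_filter (\<lambda>P. countable {z. \<not> P z})"

lemma eventually_cocountable: "eventually P cocountable \<longleftrightarrow> countable {z. \<not> P z}"
  unfolding cocountable_def
proof (rule eventually_Abs_filter, unfold_locales)
  fix P Q :: "complex \<Rightarrow> bool"
  assume "countable {z. \<not> P z}" "countable {z. \<not> Q z}"
  then show "countable {z. \<not> (P z \<and> Q z)}"
    by (rule countable_subset[OF _ countable_Un, rotated]) auto
next
  fix P Q :: "complex \<Rightarrow> bool"
  assume "\<forall>z. P z \<longrightarrow> Q z" "countable {z. \<not> P z}"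
  then show "countable {z. \<not> Q z}"
    by (elim countable_subset[rotated]) auto
qed simp

lemma cocountable_compose_inj:
  assumes "eventually P cocountable" "inj f"
  shows "eventually (\<lambda>z. P (f z)) cocountable"
proof -
  have "f ` {z. \<not> P (f z)} \<subseteq> {z. \<not> P z}"
    by auto
  then have "countable (f ` {z. \<not> P (f z)})"
    using assms(1) countable_subset by (auto simp: eventually_cocountable)
  then show ?thesis
    unfolding eventually_cocountable
    by (rule countable_image_inj_on) (use assms(2) inj_on_subset in blast)
qed

lemma cocountable_ball:
  assumes "countable I" "\<And>i. i \<in> I \<Longrightarrow> eventually (P i) cocountable"
  shows "eventually (\<lambda>z. \<forall>i\<in>I. P i z) cocountable"
proof -
  have "{z. \<not> (\<forall>i\<in>I. P i z)} = (\<Union>i\<in>I. {z. \<not> P i z})"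
    by auto
  then show ?thesis
    using assms by (simp add: eventually_cocountable)
qed

lemma cocountable_exists_in_open:
  assumes "eventually P cocountable" "open S" "S \<noteq> {}"
  shows "\<exists>z\<in>S. P z"
proof (rule ccontr)
  assume "\<not> ?thesis"
  then have "S \<subseteq> {z. \<not> P z}"
    by auto
  then have *: "countable S"
    using assms(1) countable_subset by (auto simp: eventually_cocountable)
  obtain x e where "e > 0" "ball x e \<subseteq> S"
    using assms(2,3) open_contains_ball by blast
  then show False
    using * uncountable_ball[of e x] countable_subset by blast
qed

lemma cocountable_imp_infinite:
  assumes "eventually P cocountable"
  shows "infinite {z. P z}"
proof
  assume "finite {z. P z}"
  then have "countable ({z. P z} \<union> {z. \<not> P z})"
    using assms by (intro countable_Un) (auto simp: eventually_cocountable countable_finite)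
  moreover have "{z. P z} \<union> {z. \<not> P z} = UNIV"
    by auto
  ultimately show False
    using uncountable_UNIV_complex by simp
qed

lemma cocountable_neq_bot [simp]: "cocountable \<noteq> bot"
  using cocountable_exists_in_open[of "\<lambda>_. False" UNIV] by (auto simp: trivial_limit_def)

lemma eventually_cosparse_imp_cocountable:
  assumes "eventually P (cosparse UNIV)"
  shows "eventually P cocountable"
proof -
  have "{z. \<not> P z} sparse_in UNIV"
    using assms by (simp add: eventually_cosparse)
  then have "countable (UNIV \<inter> {z. \<not> P z})"
    by (intro sparse_imp_countable) auto
  then show ?thesis
    by (simp add: eventually_cocountable)
qed

text \<open>
  The identity theorem: a discrete subset of the plane is countable.
\<close>

lemma meromorphic_const_or_avoid_cocountable:
  assumes "f meromorphic_on UNIV"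
  shows "eventually (\<lambda>z. f z = c) cocountable \<or> eventually (\<lambda>z. f z \<noteq> c) cocountable"
  using meromorphic_imp_constant_or_avoid[OF assms open_UNIV connected_UNIV, of c]
    eventually_cosparse_imp_cocountable by blast

lemma meromorphic_eq_or_neq_cocountable:
  assumes "f meromorphic_on UNIV" "g meromorphic_on UNIV"
  shows "eventually (\<lambda>z. f z = g z) cocountable \<or> eventually (\<lambda>z. f z \<noteq> g z) cocountable"
  using meromorphic_const_or_avoid_cocountable[OF meromorphic_on_diff[OF assms], of 0]
  by simp

lemma meromorphic_eq_on_open_imp_eq:
  assumes "f meromorphic_on UNIV" "g meromorphic_on UNIV" "open S" "S \<noteq> {}"
    "eventually (\<lambda>z. z \<in> S \<longrightarrow> f z = g z) cocountable"
  shows "eventually (\<lambda>z. f z = g z) cocountable"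
proof (rule ccontr)
  assume "\<not> ?thesis"
  then have "eventually (\<lambda>z. f z \<noteq> g z) cocountable"
    using meromorphic_eq_or_neq_cocountable assms by blast
  with assms(5) have "eventually (\<lambda>z. z \<notin> S) cocountable"
    by eventually_elim auto
  then show False
    using cocountable_exists_in_open assms(3,4) by blast
qed

lemma meromorphic_on_poly:
  assumes "f meromorphic_on A"
  shows "(\<lambda>z. poly p (f z)) meromorphic_on A"
  by (induction p) (auto intro!: meromorphic_intros assms)

lemma meromorphic_on_rat_eval:
  assumes "f meromorphic_on A"
  shows "(\<lambda>z. rat_eval R (f z)) meromorphic_on A"
  unfolding rat_eval_def by (intro meromorphic_intros meromorphic_on_poly assms)

lemma meromorphic_on_affine:
  assumes "f meromorphic_on UNIV"
  shows "(\<lambda>z. f (a * z + b)) meromorphic_on UNIV"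
  by (rule meromorphic_on_compose[OF assms]) (auto intro!: analytic_intros)

section \<open>Lattices\<close>

locale plane_lattice =
  fixes L :: "complex set"
  assumes lattice2: "lattice2 L"
begin

lemma ex_coordinates:
  "\<exists>f::complex \<Rightarrow> complex. linear f \<and> inj f \<and> surj f \<and> L = f ` {Complex (of_int a) (of_int b) | a b. True}"
proof -
  obtain \<omega>1 \<omega>2 where w: "\<omega>1 \<noteq> \<omega>2" "independent {\<omega>1, \<omega>2}"
    and L: "L = {of_int a * \<omega>1 + of_int b * \<omega>2 | a b. True}"
    using lattice2 unfolding lattice2_def by blast
  define f where "f = (\<lambda>z. Re z *\<^sub>R \<omega>1 + Im z *\<^sub>R \<omega>2)"
  have lin: "linear f"
    unfolding f_def by (rule linearI) (auto simp: algebra_simps)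
  have n1: "\<omega>1 \<notin> span {\<omega>2}" and n2: "\<omega>2 \<notin> span {\<omega>1}"
    using w unfolding dependent_def by (auto simp: insert_Diff_if)
  have "\<omega>1 \<noteq> 0"
    using n1 span_zero by metis
  have "z = 0" if "f z = 0" for z
  proof (rule ccontr)
    assume "z \<noteq> 0"
    have e: "Im z *\<^sub>R \<omega>2 = - Re z *\<^sub>R \<omega>1"
      using that by (simp add: f_def add_eq_0_iff)
    show False
    proof (cases "Im z = 0")
      case True
      then have "Re z = 0"
        using e \<open>\<omega>1 \<noteq> 0\<close> by simp
      with True \<open>z \<noteq> 0\<close> show False
        by (simp add: complex_eq_iff)
    next
      case False
      then have "\<omega>2 = (- Re z / Im z) *\<^sub>R \<omega>1"
        using e by (metis (no_types, lifting) divide_inverse_commute scaleR_scaleR real_vector.scale_left_imp_eq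
            left_inverse scaleR_one)
      then show False
        using n2 span_base span_mul by (metis singletonI)
    qed
  qed
  then have inj: "inj f"
    using lin by (metis linear_injective_0)
  then have "surj f"
    using lin linear_injective_imp_surjective by blast
  moreover have "f (Complex (of_int a) (of_int b)) = of_int a * \<omega>1 + of_int b * \<omega>2" for a b
    by (simp add: f_def scaleR_conv_of_real)
  then have "L = f ` {Complex (of_int a) (of_int b) | a b. True}"
    unfolding L by (auto simp: image_iff) metis
  ultimately show ?thesis
    using lin inj by blast
qed

text \<open>
  A fixed real linear automorphism of the plane carrying the Gaussian integers onto \<open>L\<close>. It
  transports size estimates and the unit square, a compact fundamental domain.
\<close>

definition coord :: "complex \<Rightarrow> complex" where
  "coord = (SOME f. linear f \<and> inj f \<and> surj f \<and> L = f ` {Complex (of_int a) (of_int b) | a b. True})"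

lemma coord: "linear coord" "inj coord" "surj coord"
  "L = coord ` {Complex (of_int a) (of_int b) | a b. True}"
  using someI_ex[OF ex_coordinates] unfolding coord_def by blast+

lemma lattice_points: "l \<in> L \<longleftrightarrow> (\<exists>a b. l = coord (Complex (of_int a) (of_int b)))"
  by (subst coord(4)) auto

lemma Complex_zero: "Complex 0 0 = 0"
  and Complex_plus: "Complex a b + Complex c d = Complex (a + c) (b + d)"
  and Complex_uminus: "- Complex a b = Complex (- a) (- b)"
  by (simp_all add: complex_eq_iff)

lemma zero_mem [simp]: "0 \<in> L"
  unfolding lattice_points using linear_0[OF coord(1)]
  by (intro exI[of _ 0]) (simp add: Complex_zero)

lemma add_mem:
  assumes "x \<in> L" "y \<in> L"
  shows "x + y \<in> L"
proof -
  obtain a b c d where "x = coord (Complex (of_int a) (of_int b))" "y = coord (Complex (of_int c) (of_int d))"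
    using assms unfolding lattice_points by blast
  then have "x + y = coord (Complex (of_int (a + c)) (of_int (b + d)))"
    by (simp add: linear_add[OF coord(1), symmetric] Complex_plus)
  then show ?thesis
    unfolding lattice_points by blast
qed

lemma uminus_mem:
  assumes "x \<in> L"
  shows "- x \<in> L"
proof -
  obtain a b where "x = coord (Complex (of_int a) (of_int b))"
    using assms unfolding lattice_points by blast
  then have "- x = coord (Complex (of_int (- a)) (of_int (- b)))"
    by (simp add: linear_neg[OF coord(1), symmetric] Complex_uminus)
  then show ?thesis
    unfolding lattice_points by blast
qed

lemma uminus_mem_iff [simp]: "- x \<in> L \<longleftrightarrow> x \<in> L"
  using uminus_mem[of x] uminus_mem[of "- x"] by auto

lemma diff_mem: "x \<in> L \<Longrightarrow> y \<in> L \<Longrightarrow> x - y \<in> L"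
  using add_mem[of x "- y"] by simp

lemma of_nat_mult_mem: "x \<in> L \<Longrightarrow> of_nat k * x \<in> L"
  by (induction k) (auto simp: algebra_simps intro: add_mem)

lemma of_int_mult_mem:
  assumes "x \<in> L"
  shows "of_int k * x \<in> L"
proof (cases "k \<ge> 0")
  case True
  then show ?thesis
    using of_nat_mult_mem[OF assms, of "nat k"] by simp
next
  case False
  then have "- (of_int k * x) = of_nat (nat (- k)) * x"
    by simp
  then show ?thesis
    using of_nat_mult_mem[OF assms, of "nat (- k)"] uminus_mem_iff by metis
qed

lemma add_mem_cancel: "x \<in> L \<Longrightarrow> y + x \<in> L \<longleftrightarrow> y \<in> L"
  using add_mem[of y x] diff_mem[of "y + x" x] by auto

lemma lattice_eq_range: "L = range (\<lambda>(a, b). coord (Complex (of_int a) (of_int b)))"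
  by (simp add: set_eq_iff lattice_points image_iff split_paired_Ex)

lemma countable_lattice: "countable L"
  by (subst lattice_eq_range) simp

lemma coord_bounded_below:
  obtains \<delta> where "\<delta> > 0" "\<And>z. \<delta> * norm z \<le> norm (coord z)"
  using linear_inj_bounded_below_pos[OF coord(1,2)] by blast

lemma finite_lattice_ball: "finite (L \<inter> cball 0 R)"
proof -
  obtain \<delta> where d: "\<delta> > 0" "\<And>z. \<delta> * norm z \<le> norm (coord z)"
    by (rule coord_bounded_below) blast
  define N where "N = \<lceil>R / \<delta>\<rceil>"
  have "L \<inter> cball 0 R \<subseteq> (\<lambda>(a, b). coord (Complex (of_int a) (of_int b))) ` ({-N..N} \<times> {-N..N})"
  proof
    fix l assume l: "l \<in> L \<inter> cball 0 R"
    then obtain a b where ab: "l = coord (Complex (of_int a) (of_int b))"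
      using lattice_points by auto
    then have "norm (Complex (of_int a) (of_int b)) \<le> R / \<delta>"
      using d(2)[of "Complex (of_int a) (of_int b)"] l d(1) by (simp add: field_simps)
    then have "\<bar>real_of_int a\<bar> \<le> R / \<delta>" "\<bar>real_of_int b\<bar> \<le> R / \<delta>"
      using abs_Re_le_cmod[of "Complex (of_int a) (of_int b)"]
        abs_Im_le_cmod[of "Complex (of_int a) (of_int b)"] by simp_all
    then have "\<bar>a\<bar> \<le> N" "\<bar>b\<bar> \<le> N"
      unfolding N_def by linarith+
    then show "l \<in> (\<lambda>(a, b). coord (Complex (of_int a) (of_int b))) ` ({-N..N} \<times> {-N..N})"
      unfolding ab by (intro image_eqI[of _ _ "(a, b)"]) auto
  qed
  then show ?thesis
    by (rule finite_subset) auto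
qed

lemma not_islimpt: "\<not> x islimpt L"
proof
  assume "x islimpt L"
  then have "infinite (L \<inter> ball x 1)"
    by (simp add: islimpt_eq_infinite_ball)
  moreover have "L \<inter> ball x 1 \<subseteq> L \<inter> cball 0 (norm x + 1)"
  proof
    fix y assume "y \<in> L \<inter> ball x 1"
    then show "y \<in> L \<inter> cball 0 (norm x + 1)"
      using norm_triangle_sub[of y x] by (auto simp: dist_norm norm_minus_commute)
  qed
  ultimately show False
    using finite_lattice_ball finite_subset by blast
qed

lemma closed_lattice: "closed L"
  using not_islimpt closed_limpt by blast

lemma open_compl: "open (- L)"
  using closed_lattice by (simp add: open_Compl)

lemma connected_compl: "connected (- L)"
  using path_connected_complement_countable[OF _ countable_lattice] path_connected_imp_connected
  by simp

lemma eventually_at_not_mem: "eventually (\<lambda>z. z \<notin> L) (at x)"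
  using not_islimpt[of x] by (simp add: islimpt_iff_eventually)

lemma cocountable_not_mem: "eventually (\<lambda>z. z \<notin> L) cocountable"
  using countable_lattice by (simp add: eventually_cocountable)

lemma punctured_radius: "\<exists>r>0. \<forall>l\<in>L - {0}. 2 * r \<le> norm l"
proof -
  obtain d where d: "d > 0" "\<forall>x\<in>L. x \<noteq> 0 \<and> dist x 0 < d \<longrightarrow> False"
    using eventually_at_not_mem[of 0] unfolding eventually_at by (metis UNIV_I)
  have "2 * (d / 2) \<le> norm l" if "l \<in> L - {0}" for l
    using d(2) that by force
  then show ?thesis
    using \<open>d > 0\<close> by (intro exI[of _ "d / 2"]) auto
qed

lemma compact_fundamental: "\<exists>K. compact K \<and> (\<forall>z. \<exists>l\<in>L. z - l \<in> K)"
proof (intro exI conjI allI)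
  let ?K = "coord ` cbox 0 (Complex 1 1)"
  show "compact ?K"
    by (intro compact_continuous_image linear_continuous_on linear_conv_bounded_linear[THEN iffD1] coord(1)) auto
  fix z
  obtain w where w: "z = coord w"
    using coord(3) by (metis surjD)
  define l where "l = Complex (of_int \<lfloor>Re w\<rfloor>) (of_int \<lfloor>Im w\<rfloor>)"
  have "coord l \<in> L"
    unfolding l_def lattice_points by blast
  moreover have "z - coord l = coord (w - l)"
    using coord(1) by (simp add: w linear_diff)
  moreover have "w - l \<in> cbox 0 (Complex 1 1)"
    unfolding l_def in_cbox_complex_iff by (auto simp: less_imp_le) linarith+
  ultimately show "\<exists>l\<in>L. z - l \<in> ?K"
    by (metis imageI)
qed

text \<open>
  In coordinates \<open>(a, b)\<close> the norm of a lattice point is comparable to \<open>max |a| |b|\<close>, whose square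
  is at least a constant times \<open>(1 + |a|)(1 + |b|)\<close>. So the sum is dominated by the product of two
  convergent one-dimensional sums with exponent \<open>3/2\<close>.
\<close>

lemma cube_summable: "(\<lambda>l. 1 / norm l ^ 3) summable_on L"
proof -
  obtain \<delta> where d: "\<delta> > 0" "\<And>z. \<delta> * norm z \<le> norm (coord z)"
    by (rule coord_bounded_below) blast
  define g :: "int \<Rightarrow> real" where "g a = (1 + \<bar>of_int a\<bar>) powr (-3/2)" for a
  have g_nonneg: "g a \<ge> 0" for a
    by (simp add: g_def)
  have "summable (\<lambda>n. g (int n))"
  proof -
    have "summable (\<lambda>n. of_nat (Suc n) powr (-3/2) :: real)"
      by (subst summable_Suc_iff) (simp add: summable_real_powr_iff)
    then show ?thesis
      by (simp add: g_def add.commute)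
  qed
  then have gn: "(\<lambda>n. g (int n)) summable_on UNIV"
    using g_nonneg by (simp add: summable_on_UNIV_nonneg_real_iff)
  have g1: "g summable_on range int"
    using gn by (subst summable_on_reindex) (auto simp: o_def)
  have g2: "g summable_on range (\<lambda>n. - int n)"
    using gn by (subst summable_on_reindex) (auto simp: o_def g_def inj_on_def)
  have U: "range int \<union> range (\<lambda>n. - int n) = UNIV"
  proof -
    have "a \<in> range int \<union> range (\<lambda>n. - int n)" for a
      by (cases a rule: int_cases2) auto
    then show ?thesis by auto
  qed
  have g: "g summable_on UNIV"
    using summable_on_union[OF g1 g2] by (simp add: U)
  have gg: "(\<lambda>(a, b). g a * g b) summable_on UNIV"
  proof -
    have "(\<lambda>(a, b). g a * g b) summable_on Sigma UNIV (\<lambda>_. UNIV)"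
    proof (rule summable_on_SigmaI)
      fix a
      show "((\<lambda>b. case (a, b) of (a, b) \<Rightarrow> g a * g b) has_sum g a * infsum g UNIV) UNIV"
        using g by (auto intro!: has_sum_cmult_right has_sum_infsum)
      show "(\<lambda>a. g a * infsum g UNIV) summable_on UNIV"
        using g by (rule summable_on_cmult_left)
    qed (auto simp: g_nonneg)
    then show ?thesis by simp
  qed
  have bound: "1 / norm (coord (Complex (of_int a) (of_int b))) ^ 3 \<le> 8 / \<delta> ^ 3 * (g a * g b)" for a b
  proof (cases "a = 0 \<and> b = 0")
    case True
    then have "coord (Complex (of_int a) (of_int b)) = 0"
      using linear_0[OF coord(1)] by (simp add: Complex_zero)
    then show ?thesis
      using d g_nonneg by simp
  next
    case False
    define N where "N = max \<bar>real_of_int a\<bar> \<bar>real_of_int b\<bar>"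
    have "max \<bar>a\<bar> \<bar>b\<bar> \<ge> 1"
      using False by auto
    then have N1: "N \<ge> 1"
      unfolding N_def by (metis of_int_1_le_iff of_int_abs of_int_max)
    have "N \<le> norm (Complex (of_int a) (of_int b))"
      using abs_Re_le_cmod[of "Complex (of_int a) (of_int b)"]
        abs_Im_le_cmod[of "Complex (of_int a) (of_int b)"] by (simp add: N_def)
    then have "\<delta> * N \<le> norm (coord (Complex (of_int a) (of_int b)))"
      using d by (meson mult_left_mono less_imp_le order_trans)
    then have "(\<delta> * N) ^ 3 \<le> norm (coord (Complex (of_int a) (of_int b))) ^ 3"
      using d(1) N1 by (intro power_mono) auto
    then have 1: "1 / norm (coord (Complex (of_int a) (of_int b))) ^ 3 \<le> 1 / (\<delta> * N) ^ 3"
      using d(1) mult_pos_pos[OF d(1), of N] N1 \<open>\<delta> * N \<le> _\<close>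
      by (intro divide_left_mono mult_pos_pos zero_less_power) linarith+
    have "(1 + \<bar>of_int a\<bar>) * (1 + \<bar>of_int b\<bar>) \<le> (2 * N) * (2 * N)"
      using N1 by (intro mult_mono) (auto simp: N_def)
    also have "\<dots> = (2 * N) powr 2"
      using N1 by (simp add: power2_eq_square)
    finally have "((1 + \<bar>of_int a\<bar>) * (1 + \<bar>of_int b\<bar>)) powr (3/2) \<le> ((2 * N) powr 2) powr (3/2)"
      by (intro powr_mono2) auto
    also have "\<dots> = (2 * N) powr 3"
      unfolding powr_powr by simp
    also have "\<dots> = (2 * N) ^ 3"
      using N1 by (intro powr_numeral) simp
    finally have "1 / (2 * N) ^ 3 \<le> 1 / ((1 + \<bar>of_int a\<bar>) * (1 + \<bar>of_int b\<bar>)) powr (3/2)"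
      using N1 by (intro divide_left_mono) (auto intro!: mult_pos_pos)
    also have "\<dots> = g a * g b"
      by (simp add: g_def powr_mult powr_minus_divide)
    finally have "8 / \<delta> ^ 3 * (1 / (2 * N) ^ 3) \<le> 8 / \<delta> ^ 3 * (g a * g b)"
      using d(1) by (intro mult_left_mono) auto
    moreover have "8 / \<delta> ^ 3 * (1 / (2 * N) ^ 3) = 1 / (\<delta> * N) ^ 3"
      by (simp add: power_mult_distrib)
    ultimately show ?thesis
      using 1 by simp
  qed
  let ?h = "\<lambda>(a, b). coord (Complex (of_int a) (of_int b))"
  have inj: "inj ?h"
    by (auto simp: inj_on_def dest!: injD[OF coord(2)])
  have "L = range ?h"
    by (rule lattice_eq_range)
  moreover have "((\<lambda>l. 1 / norm l ^ 3) \<circ> ?h) summable_on UNIV"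
  proof (rule summable_on_comparison_test)
    show "(\<lambda>p. 8 / \<delta> ^ 3 * (case p of (a, b) \<Rightarrow> g a * g b)) summable_on UNIV"
      by (rule summable_on_cmult_right[OF gg])
  qed (use bound in auto)
  ultimately show ?thesis
    using summable_on_reindex[OF inj, of "\<lambda>l. 1 / norm l ^ 3"] by (simp only:)
qed


section \<open>The Weierstrass function: convergence, symmetries and poles\<close>

text \<open>
  Because of \<open>1 / 0 = 0\<close> the term with \<open>l = 0\<close> is the principal part \<open>1 / z\<^sup>2\<close>. Thus \<open>\<wp>\<close> is a single
  sum over all of \<open>L\<close>, which can be reindexed by symmetries of \<open>L\<close>.
\<close>

definition wp_term :: "complex \<Rightarrow> complex \<Rightarrow> complex" where
  "wp_term z l = 1 / (z - l) ^ 2 - 1 / l ^ 2"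

text \<open>
  The factor 2 keeps \<open>|z - l|\<close> above \<open>|l| / 2\<close>. The numerator of the difference is \<open>z (2l - z)\<close>, so one
  power of \<open>|l|\<close> is gained over the single terms, enough for convergence.
\<close>

lemma wp_term_bound:
  assumes "norm z \<le> R" "2 * R \<le> norm l" "R > 0"
  shows "norm (wp_term z l) \<le> 10 * R * (1 / norm l ^ 3)"
proof -
  have l0: "norm l > 0" and "l \<noteq> 0"
    using assms by auto
  have zl: "norm l / 2 \<le> norm (z - l)"
    using norm_triangle_ineq2[of l z] assms by (simp add: norm_minus_commute)
  then have "z - l \<noteq> 0"
    using l0 by auto
  have "wp_term z l = (z * (2 * l - z)) / ((z - l) ^ 2 * l ^ 2)"
    using \<open>z - l \<noteq> 0\<close> \<open>l \<noteq> 0\<close> unfolding wp_term_def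
    by (simp add: diff_frac_eq) (simp add: power2_eq_square algebra_simps)
  then have "norm (wp_term z l) = norm z * norm (2 * l - z) / (norm (z - l) ^ 2 * norm l ^ 2)"
    by (simp add: norm_mult norm_divide norm_power)
  also have "\<dots> \<le> (R * (5 / 2 * norm l)) / ((norm l / 2) ^ 2 * norm l ^ 2)"
  proof (rule frac_le)
    have "norm (2 * l - z) \<le> 2 * norm l + norm z"
      using norm_triangle_ineq4[of "2 * l" z] by (simp add: norm_mult)
    then show "norm z * norm (2 * l - z) \<le> R * (5 / 2 * norm l)"
      using assms by (intro mult_mono) auto
    show "(norm l / 2) ^ 2 * norm l ^ 2 \<le> norm (z - l) ^ 2 * norm l ^ 2"
      using zl l0 by (intro mult_right_mono power_mono) auto
  qed (use assms l0 in auto)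
  also have "\<dots> = 10 * R * (1 / norm l ^ 3)"
    using l0 by (simp add: field_simps power2_eq_square power3_eq_cube)
  finally show ?thesis .
qed

lemma tail_summable:
  assumes "S \<subseteq> L" "\<And>l. l \<in> S \<Longrightarrow> 2 * R \<le> norm l" "R > 0" "norm z \<le> R"
  shows "wp_term z summable_on S"
proof (rule abs_summable_summable, rule summable_on_comparison_test)
  show "(\<lambda>l. 10 * R * (1 / norm l ^ 3)) summable_on S"
    by (rule summable_on_cmult_right[OF summable_on_subset[OF cube_summable assms(1)]])
qed (use wp_term_bound assms in auto)

text \<open>
  The terms whose poles are far from the disc converge uniformly on it by the Weierstrass test.
\<close>

lemma tail_holomorphic:
  assumes "S \<subseteq> L" "\<And>l. l \<in> S \<Longrightarrow> 2 * R \<le> norm l" "R > 0"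
  shows "(\<lambda>z. infsum (wp_term z) S) holomorphic_on ball 0 R"
proof -
  have ul: "uniform_limit (cball 0 R) (\<lambda>X z. \<Sum>l\<in>X. wp_term z l)
      (\<lambda>z. infsum (wp_term z) S) (finite_subsets_at_top S)"
  proof (rule Weierstrass_m_test_general)
    show "(\<lambda>l. 10 * R * (1 / norm l ^ 3)) summable_on S"
      by (rule summable_on_cmult_right[OF summable_on_subset[OF cube_summable assms(1)]])
  qed (use wp_term_bound assms in auto)
  have hol: "(\<lambda>z. \<Sum>l\<in>X. wp_term z l) holomorphic_on cball 0 R" if "X \<subseteq> S" for X
  proof -
    have "z \<noteq> l" if "z \<in> cball 0 R" "l \<in> X" for z l
      using assms(2)[of l] assms(3) \<open>X \<subseteq> S\<close> that by auto
    moreover have "l \<noteq> 0" if "l \<in> X" for l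
      using assms(2)[of l] assms(3) \<open>X \<subseteq> S\<close> that by auto
    ultimately show ?thesis
      unfolding wp_term_def by (intro holomorphic_intros) auto
  qed
  have "\<forall>\<^sub>F X in finite_subsets_at_top S. continuous_on (cball 0 R) (\<lambda>z. \<Sum>l\<in>X. wp_term z l) \<and>
      (\<lambda>z. \<Sum>l\<in>X. wp_term z l) holomorphic_on ball 0 R"
    using hol by (intro eventually_finite_subsets_at_top_weakI)
      (auto intro: holomorphic_on_imp_continuous_on holomorphic_on_subset[OF _ ball_subset_cball])
  then show ?thesis
    using holomorphic_uniform_limit[OF _ ul finite_subsets_at_top_neq_bot] by metis
qed

lemma wp_term_summable: "wp_term z summable_on L"
proof -
  define R where "R = norm z + 1"
  have R: "R > 0" "norm z \<le> R"
    by (auto simp: R_def add_nonneg_pos)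
  have "wp_term z summable_on (L - cball 0 (2 * R))"
    by (rule tail_summable[of _ R]) (use R in auto)
  moreover have "wp_term z summable_on (L \<inter> cball 0 (2 * R))"
    using finite_lattice_ball by simp
  ultimately have "wp_term z summable_on ((L - cball 0 (2 * R)) \<union> (L \<inter> cball 0 (2 * R)))"
    by (intro summable_on_Un_disjoint) auto
  also have "(L - cball 0 (2 * R)) \<union> (L \<inter> cball 0 (2 * R)) = L"
    by auto
  finally show ?thesis .
qed

lemma wp_eq_infsum: "wp L z = infsum (wp_term z) L"
proof -
  have L: "L = {0} \<union> (L - {0})"
    by auto
  have "infsum (wp_term z) ({0} \<union> (L - {0})) = infsum (wp_term z) {0} + infsum (wp_term z) (L - {0})"
    using summable_on_subset[OF wp_term_summable, of "L - {0}" z]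
    by (intro infsum_Un_disjoint) auto
  then show ?thesis
    using L by (simp add: wp_def wp_term_def[abs_def])
qed

lemma wp_has_sum: "(wp_term z has_sum wp L z) L"
  unfolding wp_eq_infsum by (rule has_sum_infsum[OF wp_term_summable])

lemma wp_minus: "wp L (- z) = wp L z"
proof -
  have bij: "bij_betw uminus L L"
    by (rule bij_betw_byWitness[of _ uminus]) auto
  have "(wp_term z has_sum wp L (- z)) L"
    using wp_has_sum[of "- z"]
    by (subst (asm) has_sum_reindex_bij_betw[OF bij, symmetric])
      (simp add: wp_term_def[abs_def] power2_commute)
  then show ?thesis
    using wp_has_sum has_sum_unique by blast
qed

text \<open>
  Shifting the summation index shows that \<open>\<wp>(z + \<omega>) - \<wp>(z)\<close> is the sum of \<open>1/l\<^sup>2 - 1/(l + \<omega>)\<^sup>2\<close>,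
  which no longer involves \<open>z\<close>. The symmetry \<open>l \<mapsto> -l - \<omega>\<close> of the lattice changes the sign of each
  term, so the sum vanishes.
\<close>

lemma wp_add_period:
  assumes "\<omega> \<in> L"
  shows "wp L (z + \<omega>) = wp L z"
proof -
  have bij: "bij_betw (\<lambda>l. l + \<omega>) L L"
    using assms by (intro bij_betw_byWitness[of _ "\<lambda>l. l - \<omega>"]) (auto intro: add_mem diff_mem)
  have bij': "bij_betw (\<lambda>l. - l - \<omega>) L L"
    using assms by (intro bij_betw_byWitness[of _ "\<lambda>l. - l - \<omega>"]) (auto intro: diff_mem)
  define D where "D = wp L (z + \<omega>) - wp L z"
  have "((\<lambda>l. wp_term (z + \<omega>) (l + \<omega>)) has_sum wp L (z + \<omega>)) L"
    using wp_has_sum[of "z + \<omega>"] by (subst has_sum_reindex_bij_betw[OF bij])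
  then have "((\<lambda>l. wp_term (z + \<omega>) (l + \<omega>) - wp_term z l) has_sum D) L"
    using has_sum_add[where g = "\<lambda>l. - wp_term z l" and b = "- wp L z"] wp_has_sum[of z]
    by (fastforce simp: D_def has_sum_uminus)
  then have D: "((\<lambda>l. 1 / l ^ 2 - 1 / (l + \<omega>) ^ 2) has_sum D) L"
    by (simp add: wp_term_def)
  then have "((\<lambda>l. 1 / (- l - \<omega>) ^ 2 - 1 / (- l - \<omega> + \<omega>) ^ 2) has_sum D) L"
    by (subst has_sum_reindex_bij_betw[OF bij', where f = "\<lambda>l. 1 / l ^ 2 - 1 / (l + \<omega>) ^ 2"])
  moreover have "(- l - \<omega>) ^ 2 = (l + \<omega>) ^ 2" for l
    by (simp add: power2_eq_square algebra_simps)
  ultimately have "((\<lambda>l. - (1 / l ^ 2 - 1 / (l + \<omega>) ^ 2)) has_sum D) L"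
    by simp
  then have "((\<lambda>l. 1 / l ^ 2 - 1 / (l + \<omega>) ^ 2) has_sum (- D)) L"
    by (simp only: has_sum_uminus)
  then have "- D = D"
    using D has_sum_unique by blast
  then show ?thesis
    by (simp add: D_def)
qed

lemma wp_diff_period: "\<omega> \<in> L \<Longrightarrow> wp L (z - \<omega>) = wp L z"
  using wp_add_period[of "- \<omega>" z] by simp

lemma wp_split:
  assumes "R > 0"
  obtains h where "h holomorphic_on ball 0 R"
    "\<And>z. z \<in> ball 0 R \<Longrightarrow> wp L z = (\<Sum>l\<in>L \<inter> cball 0 (2 * R). wp_term z l) + h z"
proof
  show "(\<lambda>z. infsum (wp_term z) (L - cball 0 (2 * R))) holomorphic_on ball 0 R"
    by (rule tail_holomorphic) (use assms in auto)
  fix z :: complex assume z: "z \<in> ball 0 R"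
  have "infsum (wp_term z) ((L \<inter> cball 0 (2 * R)) \<union> (L - cball 0 (2 * R)))
      = infsum (wp_term z) (L \<inter> cball 0 (2 * R)) + infsum (wp_term z) (L - cball 0 (2 * R))"
    using summable_on_subset[OF wp_term_summable] by (intro infsum_Un_disjoint) auto
  moreover have "(L \<inter> cball 0 (2 * R)) \<union> (L - cball 0 (2 * R)) = L"
    by auto
  ultimately show "wp L z = (\<Sum>l\<in>L \<inter> cball 0 (2 * R). wp_term z l)
      + infsum (wp_term z) (L - cball 0 (2 * R))"
    using finite_lattice_ball by (simp add: wp_eq_infsum)
qed

lemma wp_analytic_at:
  assumes "z \<notin> L"
  shows "wp L analytic_on {z}"
proof -
  define R where "R = norm z + 1"
  have "R > 0" and z: "z \<in> ball 0 R"
    by (auto simp: R_def add_nonneg_pos)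
  then obtain h where h: "h holomorphic_on ball 0 R"
    "\<And>z. z \<in> ball 0 R \<Longrightarrow> wp L z = (\<Sum>l\<in>L \<inter> cball 0 (2 * R). wp_term z l) + h z"
    using wp_split by blast
  let ?S = "ball 0 R - L"
  have o: "open ?S"
    using closed_lattice by auto
  have "(\<lambda>z. (\<Sum>l\<in>L \<inter> cball 0 (2 * R). wp_term z l) + h z) holomorphic_on ?S"
  proof (intro holomorphic_intros)
    fix l assume l: "l \<in> L \<inter> cball 0 (2 * R)"
    have "z - l \<noteq> 0" if "z \<in> ?S" for z
      using l that by auto
    then show "(\<lambda>z. wp_term z l) holomorphic_on ?S"
      unfolding wp_term_def by (cases "l = 0") (auto intro!: holomorphic_intros)
  qed (rule holomorphic_on_subset[OF h(1)], auto)
  then have "wp L holomorphic_on ?S"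
    by (rule holomorphic_transform) (use h(2) in auto)
  then show ?thesis
    using o z assms analytic_at by blast
qed

lemma wp_holomorphic: "wp L holomorphic_on - L"
  using wp_analytic_at open_compl analytic_on_open by (metis ComplD analytic_on_analytic_at)

lemma wp_near_0:
  obtains r \<phi> where "r > 0" "\<phi> holomorphic_on ball 0 r" "\<phi> 0 = 0"
    "\<And>z. \<phi> (- z) = \<phi> z"
    "\<And>z. wp L z = 1 / z ^ 2 + \<phi> z" "L \<inter> ball 0 r = {0}"
proof -
  obtain r where r: "r > 0" "\<And>l. l \<in> L - {0} \<Longrightarrow> 2 * r \<le> norm l"
    using punctured_radius by blast
  let ?\<phi> = "\<lambda>z. infsum (wp_term z) (L - {0})"
  have e: "wp L z = 1 / z ^ 2 + ?\<phi> z" for z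
    by (simp add: wp_def wp_term_def[abs_def])
  show ?thesis
  proof
    show "?\<phi> holomorphic_on ball 0 r"
      by (rule tail_holomorphic) (use r in auto)
    show "?\<phi> 0 = 0"
      by (intro infsum_0) (simp add: wp_term_def)
    show "?\<phi> (- z) = ?\<phi> z" for z
      using e[of z] e[of "- z"] wp_minus[of z] by simp
    show "wp L z = 1 / z ^ 2 + ?\<phi> z" for z
      by (rule e)
    show "L \<inter> ball 0 r = {0}"
      using r by fastforce
  qed (rule r)
qed

lemma wp_pole_0: "filterlim (wp L) at_infinity (at 0)"
proof -
  obtain r \<phi> where \<phi>: "r > 0" "\<phi> holomorphic_on ball 0 r" "\<phi> 0 = 0" "\<And>z. wp L z = 1 / z ^ 2 + \<phi> z"
    by (rule wp_near_0) blast
  have "continuous (at 0) \<phi>"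
    using \<phi>(1,2) by (metis at_within_open centre_in_ball continuous_on_eq_continuous_within
        holomorphic_on_imp_continuous_on open_ball)
  then have lim: "(\<phi> \<longlongrightarrow> 0) (at 0)"
    using \<phi>(3) by (simp add: continuous_at)
  have "filterlim (\<lambda>z. \<phi> z + 1 / z ^ 2) at_infinity (at 0)"
    by (rule tendsto_add_filterlim_at_infinity[OF lim])
      (auto intro!: filterlim_divide_at_infinity tendsto_eq_intros simp: filterlim_at eventually_at_filter)
  moreover have "wp L = (\<lambda>z. \<phi> z + 1 / z ^ 2)"
    by (simp add: fun_eq_iff \<phi>(4))
  ultimately show ?thesis
    by simp
qed

lemma wp_pole:
  assumes "l \<in> L"
  shows "is_pole (wp L) l"
proof -
  have "filterlim (\<lambda>z. wp L (z + l)) at_infinity (at 0)"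
    using wp_pole_0 wp_add_period[OF assms] by simp
  then show ?thesis
    by (simp add: is_pole_def filterlim_shift_iff[symmetric] at_to_0[of l] filterlim_filtermap add.commute)
qed

lemma wp_meromorphic: "wp L meromorphic_on UNIV"
proof (subst meromorphic_on_meromorphic_at, intro ballI)
  fix z
  show "wp L meromorphic_on {z}"
  proof (cases "z \<in> L")
    case True
    have "isolated_singularity_at (wp L) z"
    proof -
      have "eventually (\<lambda>w. w \<notin> L) (at z)"
        by (rule eventually_at_not_mem)
      then obtain d where "d > 0" "\<forall>w. w \<noteq> z \<and> dist w z < d \<longrightarrow> w \<notin> L"
        unfolding eventually_at by auto
      then have "wp L analytic_on ball z d - {z}"
        using wp_analytic_at by (subst analytic_on_analytic_at) (auto simp: dist_commute)
      then show ?thesis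
        using \<open>d > 0\<close> isolated_singularity_at_def by blast
    qed
    moreover have "not_essential (wp L) z"
      using wp_pole[OF True] by (simp add: not_essential_def)
    ultimately show ?thesis
      by (simp add: meromorphic_at_iff)
  qed (simp add: wp_analytic_at analytic_on_imp_meromorphic_on)
qed

text \<open>
  The values on a compact fundamental domain are all the values, so Liouville applies.
\<close>

lemma periodic_entire_constant:
  assumes "h holomorphic_on UNIV" "\<And>z l. l \<in> L \<Longrightarrow> h (z + l) = h z"
  shows "\<exists>c. \<forall>z. h z = c"
proof -
  obtain K where K: "compact K" "\<And>z. \<exists>l\<in>L. z - l \<in> K"
    using compact_fundamental by blast
  have "continuous_on K h"
    using assms(1) holomorphic_on_imp_continuous_on continuous_on_subset by blast
  then have "bounded (h ` K)"
    using K(1) compact_continuous_image compact_imp_bounded by blast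
  moreover have "range h \<subseteq> h ` K"
  proof clarify
    fix z
    obtain l where "l \<in> L" "z - l \<in> K"
      using K(2) by blast
    then show "h z \<in> h ` K"
      using assms(2)[of l "z - l"] by auto
  qed
  ultimately have "bounded (range h)"
    using bounded_subset by blast
  then show ?thesis
    using Liouville_theorem[OF assms(1)] by (auto simp: constant_on_def)
qed

text \<open>
  The limit at \<open>0\<close> is, by periodicity, the limit at every lattice point, so the function extends to an
  entire one.
\<close>

lemma periodic_off_lattice_constant:
  assumes "h holomorphic_on - L" "\<And>z l. l \<in> L \<Longrightarrow> z \<notin> L \<Longrightarrow> h (z + l) = h z"
    and lim: "(h \<longlongrightarrow> c) (at 0)"
  shows "z \<notin> L \<Longrightarrow> h z = c"
proof -
  define h' where "h' z = (if z \<in> L then c else h z)" for z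
  have shift: "eventually (\<lambda>w. h' (w + l) = h w) (at 0)" if "l \<in> L" for l
    using eventually_at_not_mem[of 0]
    by eventually_elim (use that assms(2) add_mem_cancel in \<open>auto simp: h'_def\<close>)
  have cont: "isCont h' l" if "l \<in> L" for l
  proof -
    have "((\<lambda>w. h' (w + l)) \<longlongrightarrow> c) (at 0)"
      using lim tendsto_cong[OF shift[OF that]] by blast
    then have "(h' \<longlongrightarrow> c) (at l)"
      by (simp add: at_to_0[of l] filterlim_filtermap add.commute)
    then show ?thesis
      using that by (simp add: isCont_def h'_def)
  qed
  have hol: "h' holomorphic_on - L"
    by (rule holomorphic_transform[OF assms(1)]) (simp add: h'_def)
  have "h' field_differentiable at l" for l
  proof (cases "l \<in> L")
    case False
    then show ?thesis
      using hol open_compl by (simp add: holomorphic_on_open field_differentiable_def)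
  next
    case True
    obtain d where d: "d > 0" "\<forall>w. w \<noteq> l \<and> dist w l < d \<longrightarrow> w \<notin> L"
      using eventually_at_not_mem[of l] unfolding eventually_at by auto
    have "h' holomorphic_on (ball l d - {l})"
      by (rule holomorphic_on_subset[OF hol]) (use d in \<open>auto simp: dist_commute\<close>)
    moreover have "continuous_on (ball l d) h'"
    proof (rule continuous_at_imp_continuous_on, intro ballI)
      fix w assume "w \<in> ball l d"
      then show "isCont h' w"
        using cont[of w] hol holomorphic_on_imp_continuous_on[OF hol] open_compl
        by (cases "w \<in> L") (auto simp: continuous_on_eq_continuous_at)
    qed
    ultimately have "h' holomorphic_on ball l d"
      using no_isolated_singularity[of "ball l d" h' "{l}"] by simp
    then show ?thesis
      using d(1) by (simp add: holomorphic_on_open field_differentiable_def)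
  qed
  then have "h' holomorphic_on UNIV"
    by (simp add: holomorphic_on_def)
  moreover have "h' (z + l) = h' z" if "l \<in> L" for z l
    using that assms(2)[of l z] add_mem_cancel by (auto simp: h'_def)
  ultimately obtain c' where c': "\<And>z. h' z = c'"
    using periodic_entire_constant by blast
  then have "c' = c"
    using c'[of 0] by (simp add: h'_def)
  then show "z \<notin> L \<Longrightarrow> h z = c"
    using c'[of z] by (simp add: h'_def)
qed

end

text \<open>
  The derivative at \<open>0\<close> of an even function vanishes, so a zero at \<open>0\<close> is at least double.
\<close>

lemma even_zero_factor:
  assumes "\<phi> holomorphic_on ball 0 r" "r > 0" "\<phi> 0 = 0" "\<And>z. z \<in> ball 0 r \<Longrightarrow> \<phi> (- z) = \<phi> z"
  obtains \<psi> where "\<psi> holomorphic_on ball 0 r" "\<And>z. z \<in> ball 0 r \<Longrightarrow> \<phi> z = z ^ 2 * \<psi> z"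
proof -
  have d: "(\<phi> has_field_derivative deriv \<phi> 0) (at 0)"
    using assms(1,2) by (intro holomorphic_derivI[of _ "ball 0 r"]) auto
  then have "(\<phi> has_field_derivative deriv \<phi> 0) (at (- 0))"
    by simp
  then have "((\<lambda>z. \<phi> (- z)) has_field_derivative (deriv \<phi> 0 * (- 1))) (at 0)"
    by (rule DERIV_chain2) (auto intro!: derivative_eq_intros)
  then have "(\<phi> has_field_derivative (deriv \<phi> 0 * (- 1))) (at 0)"
    by (rule has_field_derivative_transform_within_open[of _ _ _ "ball 0 r"]) (use assms(2,4) in auto)
  then have d0: "deriv \<phi> 0 = 0"
    using d DERIV_unique by fastforce
  define \<psi>1 where "\<psi>1 z = (if z = 0 then deriv \<phi> 0 else (\<phi> z - \<phi> 0) / (z - 0))" for z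
  define \<psi> where "\<psi> z = (if z = 0 then deriv \<psi>1 0 else (\<psi>1 z - \<psi>1 0) / (z - 0))" for z
  have "\<psi>1 holomorphic_on ball 0 r"
    unfolding \<psi>1_def by (rule pole_lemma_open) (use assms in auto)
  then have "\<psi> holomorphic_on ball 0 r"
    unfolding \<psi>_def by (rule pole_lemma_open) auto
  moreover have "\<phi> z = z ^ 2 * \<psi> z" for z
    using assms(3) d0 by (auto simp: \<psi>_def \<psi>1_def power2_eq_square)
  ultimately show ?thesis
    using that by blast
qed

text \<open>
  The function extended by \<open>g(0) = 0\<close> is even and holomorphic, so its zero is at least double. Used to
  lower the pole order of an even elliptic function by two.
\<close>

lemma even_removable_zero_factor:
  assumes hol: "g holomorphic_on ball 0 r - {0}" and "r > 0" and lim: "(g \<longlongrightarrow> 0) (at 0)"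
    and even: "\<And>z. z \<in> ball 0 r - {0} \<Longrightarrow> g (- z) = g z"
  obtains c where "((\<lambda>z. g z / z ^ 2) \<longlongrightarrow> c) (at 0)"
proof -
  define g0 where "g0 z = (if z = 0 then 0 else g z)" for z
  have lim0: "(g0 \<longlongrightarrow> 0) (at 0)"
    using lim by (rule Lim_transform_eventually) (auto simp: g0_def eventually_at_filter)
  have hol0: "g0 holomorphic_on ball 0 r - {0}"
    by (rule holomorphic_transform[OF hol]) (simp add: g0_def)
  have "g0 holomorphic_on ball 0 r"
    by (rule no_isolated_singularity'[of "{0}"])
      (use lim0 hol0 in \<open>auto intro: tendsto_within_subset simp: g0_def\<close>)
  then obtain \<psi> where \<psi>: "\<psi> holomorphic_on ball 0 r" "\<And>z. z \<in> ball 0 r \<Longrightarrow> g0 z = z ^ 2 * \<psi> z"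
    by (rule even_zero_factor) (use even \<open>r > 0\<close> in \<open>auto simp: g0_def\<close>)
  have "isCont \<psi> 0"
    using \<psi>(1) \<open>r > 0\<close> by (metis centre_in_ball continuous_on_eq_continuous_at holomorphic_on_imp_continuous_on open_ball)
  then have "(\<psi> \<longlongrightarrow> \<psi> 0) (at 0)"
    by (simp add: isCont_def)
  moreover have "eventually (\<lambda>z. \<psi> z = g z / z ^ 2) (at 0)"
  proof -
    have "eventually (\<lambda>z. z \<in> ball 0 r - {0}) (at (0::complex))"
      using \<open>r > 0\<close> by (intro eventually_at_in_open) auto
    then show ?thesis
    proof eventually_elim
      case (elim z)
      then have "g z = z ^ 2 * \<psi> z"
        using \<psi>(2)[of z] by (auto simp: g0_def)
      then show ?case
        using elim by simp
    qed
  qed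
  ultimately have "((\<lambda>z. g z / z ^ 2) \<longlongrightarrow> \<psi> 0) (at 0)"
    by (rule Lim_transform_eventually)
  then show ?thesis
    by (rule that)
qed

lemma deriv_shift_periodic:
  fixes f :: "complex \<Rightarrow> complex"
  assumes "\<And>z. f (z + l) = f z"
  shows "deriv f (z + l) = deriv f z"
proof -
  have "(\<lambda>x. f (x + l)) = f"
    using assms by auto
  then have "(f has_field_derivative D) (at (z + l)) \<longleftrightarrow> (f has_field_derivative D) (at z)" for D
    using DERIV_shift[of f D z l] by simp
  then show ?thesis
    by (simp add: deriv_def)
qed

context plane_lattice
begin

section \<open>Differential equations and fibres\<close>

abbreviation "wp' \<equiv> deriv (wp L)"

lemma wp_has_deriv: "z \<notin> L \<Longrightarrow> (wp L has_field_derivative wp' z) (at z)"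
  using wp_holomorphic open_compl by (intro holomorphic_derivI) auto

lemma wp'_holomorphic: "wp' holomorphic_on - L"
  using wp_holomorphic open_compl by (rule holomorphic_deriv)

lemma wp'_has_deriv: "z \<notin> L \<Longrightarrow> (wp' has_field_derivative deriv wp' z) (at z)"
  using wp'_holomorphic open_compl by (intro holomorphic_derivI) auto

lemma wp''_holomorphic: "deriv wp' holomorphic_on - L"
  using wp'_holomorphic open_compl by (rule holomorphic_deriv)

lemma wp'_minus:
  assumes "z \<notin> L"
  shows "wp' (- z) = - wp' z"
proof -
  have "(wp L has_field_derivative wp' (- z)) (at (- z))"
    using assms by (intro wp_has_deriv) simp
  then have "((\<lambda>z. wp L (- z)) has_field_derivative (wp' (- z) * (- 1))) (at z)"
    by (rule DERIV_chain2) (auto intro!: derivative_eq_intros)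
  then have "(wp L has_field_derivative (wp' (- z) * (- 1))) (at z)"
    by (simp add: wp_minus)
  then show ?thesis
    using wp_has_deriv[OF assms] DERIV_unique by fastforce
qed

text \<open>
  Near \<open>0\<close> write \<open>\<wp>(z) = 1/z\<^sup>2 + z\<^sup>2 \<psi>(z)\<close>, where evenness and the vanishing constant term provide the
  factor \<open>z\<^sup>2\<close>. The poles of \<open>\<wp>''\<close> and \<open>6\<wp>\<^sup>2\<close> then cancel, and the difference is an elliptic function
  without poles.
\<close>

lemma wp_second_order_ode: "\<exists>C. \<forall>z. z \<notin> L \<longrightarrow> deriv wp' z = 6 * wp L z ^ 2 + C"
proof -
  obtain r \<phi> where r: "r > 0" and \<phi>: "\<phi> holomorphic_on ball 0 r" "\<phi> 0 = 0" "\<And>z. \<phi> (- z) = \<phi> z"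
    and wp: "\<And>z. wp L z = 1 / z ^ 2 + \<phi> z" and Lr: "L \<inter> ball 0 r = {0}"
    by (rule wp_near_0) blast
  obtain \<psi> where \<psi>: "\<psi> holomorphic_on ball 0 r" "\<And>z. z \<in> ball 0 r \<Longrightarrow> \<phi> z = z ^ 2 * \<psi> z"
    by (rule even_zero_factor[OF \<phi>(1) r \<phi>(2)]) (use \<phi>(3) in auto)
  let ?S = "ball 0 r - {0::complex}"
  have S: "open ?S" "?S \<subseteq> - L"
    using Lr by auto
  have \<phi>d: "(\<phi> has_field_derivative deriv \<phi> z) (at z)" if "z \<in> ?S" for z
    using \<phi>(1) that by (intro holomorphic_derivI) auto
  have \<phi>'hol: "deriv \<phi> holomorphic_on ball 0 r"
    using \<phi>(1) by (intro holomorphic_deriv) auto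
  then have \<phi>dd: "(deriv \<phi> has_field_derivative deriv (deriv \<phi>) z) (at z)" if "z \<in> ?S" for z
    using that by (intro holomorphic_derivI) auto
  have d1: "wp' z = - 2 / z ^ 3 + deriv \<phi> z" if "z \<in> ?S" for z
  proof -
    have "((\<lambda>z. 1 / z ^ 2 + \<phi> z) has_field_derivative (- 2 / z ^ 3 + deriv \<phi> z)) (at z)"
      using that by (auto intro!: derivative_eq_intros \<phi>d simp: power2_eq_square power3_eq_cube)
    then show ?thesis
      using wp by (metis (no_types, lifting) DERIV_imp_deriv ext)
  qed
  have d2: "deriv wp' z = 6 / z ^ 4 + deriv (deriv \<phi>) z" if z: "z \<in> ?S" for z
  proof -
    have "((\<lambda>z. - 2 / z ^ 3 + deriv \<phi> z) has_field_derivative (6 / z ^ 4 + deriv (deriv \<phi>) z)) (at z)"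
      using that by (auto intro!: derivative_eq_intros \<phi>dd simp: eval_nat_numeral field_simps)
    then have "(wp' has_field_derivative (6 / z ^ 4 + deriv (deriv \<phi>) z)) (at z)"
      by (rule has_field_derivative_transform_within_open[OF _ S(1) z]) (simp add: d1)
    then show ?thesis
      by (rule DERIV_imp_deriv)
  qed
  define h where "h z = deriv wp' z - 6 * wp L z ^ 2" for z
  have "h holomorphic_on - L"
    unfolding h_def by (intro holomorphic_intros wp_holomorphic wp''_holomorphic)
  moreover have "h (z + l) = h z" if "l \<in> L" for z l
    using that by (simp add: h_def wp_add_period deriv_shift_periodic)
  moreover
  define h0 where "h0 z = deriv (deriv \<phi>) z - 12 * \<psi> z - 6 * \<phi> z ^ 2" for z
  have "(h \<longlongrightarrow> h0 0) (at 0)"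
  proof (rule Lim_transform_eventually)
    have "h0 holomorphic_on ball 0 r"
      unfolding h0_def using \<phi>'hol by (intro holomorphic_intros \<phi> \<psi> holomorphic_deriv) auto
    then have "isCont h0 0"
      using r by (metis centre_in_ball continuous_on_eq_continuous_at holomorphic_on_imp_continuous_on open_ball)
    then show "(h0 \<longlongrightarrow> h0 0) (at 0)"
      by (simp add: isCont_def)
    have "eventually (\<lambda>z. z \<in> ?S) (at (0::complex))"
      using r by (intro eventually_at_in_open) auto
    then show "eventually (\<lambda>z. h0 z = h z) (at 0)"
    proof eventually_elim
      case (elim z)
      then have "z \<noteq> 0" "z \<in> ball 0 r"
        by auto
      have "wp L z ^ 2 = 1 / z ^ 4 + 2 * \<psi> z + \<phi> z ^ 2"
        using \<open>z \<noteq> 0\<close> \<psi>(2)[OF \<open>z \<in> ball 0 r\<close>] unfolding wp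
        by (simp add: power2_sum power_divide)
      then show ?case
        unfolding h_def h0_def d2[OF elim] by simp
    qed
  qed
  ultimately have "h z = h0 0" if "z \<notin> L" for z
    using periodic_off_lattice_constant[of h] that by blast
  then show ?thesis
    by (intro exI[of _ "h0 0"]) (auto simp: h_def algebra_simps)
qed

text \<open>
  Multiply the equation of second order by \<open>2\<wp>'\<close> and integrate. The constant of integration is the
  same everywhere since the complement of a countable set is connected.
\<close>

lemma wp_first_order_ode: "\<exists>C D. \<forall>z. z \<notin> L \<longrightarrow> wp' z ^ 2 = 4 * wp L z ^ 3 + C * wp L z + D"
proof -
  obtain C where C: "\<And>z. z \<notin> L \<Longrightarrow> deriv wp' z = 6 * wp L z ^ 2 + C"
    using wp_second_order_ode by blast
  define E where "E z = wp' z ^ 2 - 4 * wp L z ^ 3 - 2 * C * wp L z" for z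
  have "(E has_field_derivative 0) (at z)" if "z \<in> - L" for z
  proof -
    have "(wp L has_field_derivative wp' z) (at z)" "(wp' has_field_derivative (6 * wp L z ^ 2 + C)) (at z)"
      using that wp_has_deriv[of z] wp'_has_deriv[of z] C[of z] by auto
    then have "(E has_field_derivative (2 * wp' z * (6 * wp L z ^ 2 + C)
        - 4 * (3 * wp L z ^ 2 * wp' z) - 2 * C * wp' z)) (at z)"
      unfolding E_def by - (rule derivative_eq_intros refl | assumption | simp)+
    then show ?thesis
      by (simp add: algebra_simps)
  qed
  then have "E constant_on - L"
    using has_field_derivative_0_imp_constant_on connected_compl open_compl by blast
  then obtain D where "\<And>z. z \<notin> L \<Longrightarrow> E z = D"
    by (auto simp: constant_on_def)
  then have "wp' z ^ 2 = 4 * wp L z ^ 3 + 2 * C * wp L z + D" if "z \<notin> L" for z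
    using that by (auto simp: E_def algebra_simps)
  then show ?thesis
    by blast
qed

text \<open>
  A period carries the pole at \<open>0\<close> to another pole.
\<close>

lemma wp_period_mem:
  assumes "eventually (\<lambda>z. wp L (z + t) = wp L z) cocountable"
  shows "t \<in> L"
proof (rule ccontr)
  assume t: "t \<notin> L"
  then have "isCont (wp L) t"
    using wp_analytic_at analytic_at_imp_isCont by blast
  then have lim: "((\<lambda>z. wp L (z + t)) \<longlongrightarrow> wp L t) (at 0)"
    using LIM_offset_zero[of "wp L" "wp L t" t] by (simp add: isCont_def add.commute)
  define B where "B = norm (wp L t) + 1"
  have "eventually (\<lambda>z. norm (wp L (z + t)) < B) (at 0)"
    using order_tendstoD(2)[OF tendsto_norm[OF lim], of B] by (simp add: B_def)
  moreover have "eventually (\<lambda>z. norm (wp L z) \<ge> B) (at 0)"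
    using wp_pole_0 by (simp add: filterlim_at_infinity[of "0"] B_def) (metis add_nonneg_pos norm_ge_zero zero_less_one)
  ultimately have "eventually (\<lambda>z. wp L (z + t) \<noteq> wp L z) (at 0)"
    by eventually_elim auto
  then obtain d where d: "d > 0" "\<And>z. z \<noteq> 0 \<Longrightarrow> dist z 0 < d \<Longrightarrow> wp L (z + t) \<noteq> wp L z"
    unfolding eventually_at by blast
  have "of_real (d / 2) \<in> ball 0 d - {0 :: complex}"
    using d(1) by auto
  then have "ball 0 d - {0 :: complex} \<noteq> {}"
    by blast
  then have "\<exists>z\<in>ball 0 d - {0}. wp L (z + t) = wp L z"
    by (intro cocountable_exists_in_open[OF assms]) auto
  then show False
    using d(2) by auto
qed

text \<open>
  By the equation of second order every higher derivative of \<open>\<wp>\<close> is the same polynomial in the lower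
  ones at every point. So the Taylor series at \<open>a\<close> and \<open>w\<close> agree, and \<open>a - w\<close> is a period of \<open>\<wp>\<close>.
\<close>

lemma wp_same_jet:
  assumes a: "a \<notin> L" and w: "w \<notin> L" and eq: "wp L a = wp L w" "wp' a = wp' w"
  shows "a - w \<in> L"
proof -
  obtain C where C: "\<And>z. z \<notin> L \<Longrightarrow> deriv wp' z = 6 * wp L z ^ 2 + C"
    using wp_second_order_ode by blast
  have rec: "(deriv ^^ Suc (Suc n)) (wp L) z =
      6 * (\<Sum>i = 0..n. of_nat (n choose i) * (deriv ^^ i) (wp L) z * (deriv ^^ (n-i)) (wp L) z)
      + (if n = 0 then C else 0)" if z: "z \<notin> L" for n z
  proof -
    have "(deriv ^^ Suc (Suc n)) (wp L) z = (deriv ^^ n) (deriv wp') z"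
      by (simp add: funpow_swap1)
    also have "\<dots> = (deriv ^^ n) (\<lambda>z. 6 * (wp L z * wp L z) + C) z"
      by (rule higher_deriv_transform_within_open[OF wp''_holomorphic _ open_compl])
        (use z C in \<open>auto intro!: holomorphic_intros wp_holomorphic simp: power2_eq_square\<close>)
    also have "\<dots> = (deriv ^^ n) (\<lambda>z. 6 * (wp L z * wp L z)) z + (deriv ^^ n) (\<lambda>z. C) z"
      by (rule higher_deriv_add[OF _ _ open_compl]) (use z in \<open>auto intro!: holomorphic_intros wp_holomorphic\<close>)
    also have "(deriv ^^ n) (\<lambda>z. 6 * (wp L z * wp L z)) z = 6 * (deriv ^^ n) (\<lambda>z. wp L z * wp L z) z"
      by (rule higher_deriv_cmult[OF _ _ open_compl]) (use z in \<open>auto intro!: holomorphic_intros wp_holomorphic\<close>)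
    also have "(deriv ^^ n) (\<lambda>z. wp L z * wp L z) z =
        (\<Sum>i = 0..n. of_nat (n choose i) * (deriv ^^ i) (wp L) z * (deriv ^^ (n-i)) (wp L) z)"
      by (rule higher_deriv_mult[OF _ _ open_compl]) (use z in \<open>auto intro!: holomorphic_intros wp_holomorphic\<close>)
    finally show ?thesis
      by simp
  qed
  have jets: "(deriv ^^ n) (wp L) a = (deriv ^^ n) (wp L) w" for n
  proof (induction n rule: less_induct)
    case (less n)
    consider "n = 0" | "n = 1" | m where "n = Suc (Suc m)"
      by (metis One_nat_def not0_implies_Suc)
    then show ?case
    proof cases
      case 3
      have "(\<Sum>i = 0..m. of_nat (m choose i) * (deriv ^^ i) (wp L) a * (deriv ^^ (m-i)) (wp L) a) =
          (\<Sum>i = 0..m. of_nat (m choose i) * (deriv ^^ i) (wp L) w * (deriv ^^ (m-i)) (wp L) w)"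
        by (rule sum.cong) (auto simp: less.IH 3)
      then show ?thesis
        unfolding 3 rec[OF a] rec[OF w] by simp
    qed (use eq in auto)
  qed
  define t where "t = a - w"
  obtain r1 r2 where r1: "r1 > 0" "ball w r1 \<subseteq> - L" and r2: "r2 > 0" "ball a r2 \<subseteq> - L"
    using a w open_compl open_contains_ball by (metis ComplI)
  define r where "r = min r1 r2"
  have r: "r > 0" "ball w r \<subseteq> - L"
    using r1 r2 by (auto simp: r_def)
  have at: "1 * z + t \<in> - L" if "z \<in> ball w r" for z
    using that r2(2) by (auto simp: r_def t_def dist_norm subset_iff algebra_simps)
  have hol: "(\<lambda>z. wp L (1 * z + t)) holomorphic_on ball w r"
    using at by (intro holomorphic_on_compose_gen[OF _ wp_holomorphic, unfolded o_def])
      (auto intro!: holomorphic_intros)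
  have "wp L (1 * z + t) = wp L z" if z: "z \<in> ball w r" for z
  proof (rule holomorphic_fun_eq_on_ball[OF hol holomorphic_on_subset[OF wp_holomorphic r(2)] z])
    fix n
    have "(deriv ^^ n) (\<lambda>z. wp L (1 * z + t)) w = 1 ^ n * (deriv ^^ n) (wp L) (1 * w + t)"
      by (rule higher_deriv_compose_linear'[OF wp_holomorphic open_ball open_compl]) (use at r in auto)
    then show "(deriv ^^ n) (\<lambda>z. wp L (1 * z + t)) w = (deriv ^^ n) (wp L) w"
      using jets by (simp add: t_def)
  qed
  then have "eventually (\<lambda>z. z \<in> ball w r \<longrightarrow> wp L (1 * z + t) = wp L z) cocountable"
    by (intro always_eventually) auto
  then have "eventually (\<lambda>z. wp L (1 * z + t) = wp L z) cocountable"
    by (intro meromorphic_eq_on_open_imp_eq[OF meromorphic_on_affine[OF wp_meromorphic] wp_meromorphic open_ball])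
      (use r in auto)
  then show ?thesis
    using wp_period_mem[of t] by (simp add: t_def)
qed

text \<open>
  By the equation of first order, \<open>\<wp>(a) = \<wp>(w)\<close> implies that \<open>\<wp>'(a)\<close> is \<open>\<wp>'(w)\<close> or
  \<open>- \<wp>'(w) = \<wp>'(-w)\<close>. So \<open>a\<close> has the same jet as \<open>w\<close> or as \<open>-w\<close>.
\<close>

theorem wp_eq_iff:
  assumes a: "a \<notin> L" and w: "w \<notin> L"
  shows "wp L a = wp L w \<longleftrightarrow> a - w \<in> L \<or> a + w \<in> L"
proof
  assume eq: "wp L a = wp L w"
  obtain C D where "\<And>z. z \<notin> L \<Longrightarrow> wp' z ^ 2 = 4 * wp L z ^ 3 + C * wp L z + D"
    using wp_first_order_ode by blast
  then have "wp' a ^ 2 = wp' w ^ 2"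
    using a w eq by simp
  then consider "wp' a = wp' w" | "wp' a = wp' (- w)"
    using wp'_minus[OF w] power2_eq_iff by metis
  then show "a - w \<in> L \<or> a + w \<in> L"
  proof cases
    case 1
    then show ?thesis
      using wp_same_jet[OF a w eq] by simp
  next
    case 2
    then show ?thesis
      using wp_same_jet[OF a, of "- w"] w eq by (simp add: wp_minus)
  qed
next
  assume "a - w \<in> L \<or> a + w \<in> L"
  then show "wp L a = wp L w"
    using wp_add_period[of "a - w" w] wp_add_period[of "a + w" "- w"] by (auto simp: wp_minus)
qed

lemma ex_not_mem: "\<exists>z. z \<notin> L"
  using cocountable_exists_in_open[OF cocountable_not_mem open_UNIV] by auto

text \<open>
  An omitted value \<open>c\<close> would make \<open>1 / (\<wp> - c)\<close> an elliptic function without poles that vanishes on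
  the lattice.
\<close>

theorem wp_surj: "\<exists>w. w \<notin> L \<and> wp L w = c"
proof (rule ccontr)
  assume "\<not> ?thesis"
  then have ne: "\<And>w. w \<notin> L \<Longrightarrow> wp L w - c \<noteq> 0"
    by auto
  define h where "h z = inverse (wp L z - c)" for z
  have "h holomorphic_on - L"
    unfolding h_def using ne by (intro holomorphic_intros wp_holomorphic) auto
  moreover have "h (z + l) = h z" if "l \<in> L" for z l
    using that by (simp add: h_def wp_add_period)
  moreover have "filterlim (\<lambda>z. - c + wp L z) at_infinity (at 0)"
    by (rule tendsto_add_filterlim_at_infinity[OF tendsto_const wp_pole_0])
  then have "filterlim (\<lambda>z. wp L z - c) at_infinity (at 0)"
    by simp
  then have "(h \<longlongrightarrow> 0) (at 0)"
    unfolding h_def by (rule filterlim_compose[OF tendsto_inverse_0])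
  ultimately have "h z = 0" if "z \<notin> L" for z
    using periodic_off_lattice_constant[of h 0] that by blast
  then show False
    using ex_not_mem ne by (auto simp: h_def)
qed

lemma wp_image_cocountable:
  assumes "eventually P cocountable"
  shows "eventually (\<lambda>x. \<exists>z. z \<notin> L \<and> P z \<and> wp L z = x) cocountable"
proof -
  have "{x. \<not> (\<exists>z. z \<notin> L \<and> P z \<and> wp L z = x)} \<subseteq> wp L ` {z. \<not> P z}"
    using wp_surj by (auto simp: image_iff) metis
  then show ?thesis
    using assms unfolding eventually_cocountable by (meson countable_image countable_subset)
qed


section \<open>Even elliptic functions and isogenies\<close>

lemma wp_lim_0: "((\<lambda>z. z ^ 2 * wp L z) \<longlongrightarrow> 1) (at 0)"
proof -
  obtain r \<phi> where \<phi>: "r > 0" "\<phi> holomorphic_on ball 0 r" "\<And>z. wp L z = 1 / z ^ 2 + \<phi> z"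
    by (rule wp_near_0) blast
  have "isCont \<phi> 0"
    using \<phi>(1,2) by (metis centre_in_ball continuous_on_eq_continuous_at holomorphic_on_imp_continuous_on open_ball)
  then have "(\<phi> \<longlongrightarrow> \<phi> 0) (at 0)"
    by (simp add: isCont_def)
  then have "((\<lambda>z. 1 + z ^ 2 * \<phi> z) \<longlongrightarrow> 1) (at 0)"
    by (auto intro!: tendsto_eq_intros)
  moreover have "eventually (\<lambda>z. 1 + z ^ 2 * \<phi> z = z ^ 2 * wp L z) (at 0)"
    by (simp add: eventually_at_filter \<phi>(3) distrib_left)
  ultimately show ?thesis
    by (rule Lim_transform_eventually)
qed

lemma wp_lim_lattice:
  assumes "l \<in> L"
  shows "((\<lambda>z. (z - l) ^ 2 * wp L z) \<longlongrightarrow> 1) (at l)"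
proof -
  have "((\<lambda>z. (z - l) ^ 2 * wp L (z - l)) \<longlongrightarrow> 1) (at (0 + l))"
    using LIM_offset[OF wp_lim_0, of "- l"] by simp
  then show ?thesis
    using wp_diff_period[OF assms] by simp
qed

text \<open>
  Subtracting a multiple of a power of \<open>\<wp>\<close> removes the leading term at the pole. What remains is
  again even, so its pole order drops by two. Without poles the function is constant.
\<close>

theorem even_elliptic_is_polynomial:
  assumes "h holomorphic_on - L" "\<And>z. z \<notin> L \<Longrightarrow> h (- z) = h z"
    "\<And>z l. z \<notin> L \<Longrightarrow> l \<in> L \<Longrightarrow> h (z + l) = h z"
    "((\<lambda>z. z ^ (2 * k) * h z) \<longlongrightarrow> c) (at 0)"
  shows "\<exists>q. \<forall>z. z \<notin> L \<longrightarrow> h z = poly q (wp L z)"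
  using assms
proof (induction k arbitrary: h c)
  case 0
  have lim: "(h \<longlongrightarrow> c) (at 0)"
    using 0(4) by simp
  have "h z = c" if "z \<notin> L" for z
    by (rule periodic_off_lattice_constant[OF 0(1) _ lim that]) (use 0(3) in blast)
  then show ?case
    by (intro exI[of _ "[:c:]"]) simp
next
  case (Suc k)
  define h1 where "h1 z = h z - c * wp L z ^ Suc k" for z
  define g where "g z = z ^ (2 * Suc k) * h1 z" for z
  obtain r where r: "r > 0" "L \<inter> ball 0 r = {0}"
    using wp_near_0 by metis
  have hol1: "h1 holomorphic_on - L"
    unfolding h1_def by (intro holomorphic_intros Suc.prems(1) wp_holomorphic)
  have even1: "h1 (- z) = h1 z" if "z \<notin> L" for z
    using Suc.prems(2) that by (simp add: h1_def wp_minus)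
  have per1: "h1 (z + l) = h1 z" if "z \<notin> L" "l \<in> L" for z l
    using Suc.prems(3) that by (simp add: h1_def wp_add_period)
  have "((\<lambda>z. z ^ (2 * Suc k) * h z - c * (z ^ 2 * wp L z) ^ Suc k) \<longlongrightarrow> c - c * 1 ^ Suc k) (at 0)"
    by (intro tendsto_intros Suc.prems(4) wp_lim_0)
  moreover have "(z ^ 2 * wp L z) ^ Suc k = z ^ (2 * Suc k) * wp L z ^ Suc k" for z
    by (simp only: power_mult_distrib power_mult)
  ultimately have "((\<lambda>z. z ^ (2 * Suc k) * h z - c * (z ^ (2 * Suc k) * wp L z ^ Suc k)) \<longlongrightarrow> 0) (at 0)"
    by (simp only: power_one mult_1_right diff_self)
  moreover have "g = (\<lambda>z. z ^ (2 * Suc k) * h z - c * (z ^ (2 * Suc k) * wp L z ^ Suc k))"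
    by (simp only: g_def h1_def fun_eq_iff right_diff_distrib mult.left_commute) simp
  ultimately have lim: "(g \<longlongrightarrow> 0) (at 0)"
    by (simp only:)
  have sub: "ball 0 r - {0} \<subseteq> - L"
    using r by auto
  have "g holomorphic_on ball 0 r - {0}"
    unfolding g_def by (intro holomorphic_intros holomorphic_on_subset[OF hol1 sub])
  moreover have "g (- z) = g z" if "z \<in> ball 0 r - {0}" for z
  proof -
    have "z \<notin> L"
      using sub that by blast
    then show ?thesis
      using even1 by (simp add: g_def power_mult del: power_Suc mult_Suc_right)
  qed
  ultimately obtain c' where "((\<lambda>z. g z / z ^ 2) \<longlongrightarrow> c') (at 0)"
    using even_removable_zero_factor[OF _ r(1) lim] by blast
  moreover have "eventually (\<lambda>z. g z / z ^ 2 = z ^ (2 * k) * h1 z) (at 0)"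
    by (simp add: eventually_at_filter g_def power_add power2_eq_square)
  ultimately have "((\<lambda>z. z ^ (2 * k) * h1 z) \<longlongrightarrow> c') (at 0)"
    by (rule Lim_transform_eventually)
  then obtain q where "\<And>z. z \<notin> L \<Longrightarrow> h1 z = poly q (wp L z)"
    using Suc.IH[OF hol1 even1 per1] by blast
  then have "h z = poly (q + monom c (Suc k)) (wp L z)" if "z \<notin> L" for z
    using that by (simp add: h1_def poly_monom algebra_simps)
  then show ?case
    by blast
qed

text \<open>
  There are finitely many classes of \<open>M\<close> modulo \<open>L\<close>. For each nonzero class, with representative
  \<open>t\<close>, the function \<open>(\<wp>\<^bsub>L\<^esub>(z) - \<wp>\<^bsub>L\<^esub>(t))\<^sup>2\<close> cancels the double pole of \<open>\<wp>\<^bsub>M\<^esub>\<close> there. The product of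
  all these factors with \<open>\<wp>\<^bsub>M\<^esub>\<close> has poles in \<open>L\<close> only, hence is a polynomial in \<open>\<wp>\<^bsub>L\<^esub>\<close>. The factors
  have no zeros outside \<open>M\<close> by the description of the fibres.
\<close>

theorem wp_superlattice_rational:
  assumes M: "plane_lattice M" and LM: "L \<subseteq> M"
  shows "\<exists>R. \<forall>z. z \<notin> M \<longrightarrow> poly (denom R) (wp L z) \<noteq> 0 \<and> wp M z = rat_eval R (wp L z)"
proof -
  interpret M: plane_lattice M
    by (rule M)
  obtain K where K: "compact K" "\<And>z. \<exists>l\<in>L. z - l \<in> K"
    using compact_fundamental by blast
  (* One may take representatives in a compact fundamental domain of L, which makes T finite. *)
  define T where "T = (M \<inter> K) - L"
  have finT: "finite T"
  proof -
    obtain B where "K \<subseteq> cball 0 B"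
      using compact_imp_bounded[OF K(1)] by (auto simp: bounded_iff subset_iff)
    then have "T \<subseteq> M \<inter> cball 0 B"
      by (auto simp: T_def)
    then show ?thesis
      using M.finite_lattice_ball finite_subset by blast
  qed
  have T: "T \<subseteq> M - L"
    by (auto simp: T_def)
  define Q where "Q z = (\<Prod>t\<in>T. (wp L z - wp L t) ^ 2)" for z
  define F where "F z = Q z * wp M z" for z
  (* The product F is undefined at the points of M outside L; its limits there are the values
  of the elliptic function wanted. *)
  define h where "h = remove_sings F"
  have Q_hol: "Q holomorphic_on - L"
    unfolding Q_def by (intro holomorphic_intros wp_holomorphic)
  have F_hol: "F holomorphic_on - M"
    unfolding F_def using LM
    by (intro holomorphic_intros holomorphic_on_subset[OF Q_hol] M.wp_holomorphic) auto
  then have F_an: "F analytic_on {z}" if "z \<notin> M" for z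
    using that M.open_compl analytic_at by (metis ComplI)
  have F_iso: "isolated_singularity_at F z" for z
  proof -
    obtain d where "d > 0" "\<forall>w. w \<noteq> z \<and> dist w z < d \<longrightarrow> w \<notin> M"
      using M.eventually_at_not_mem[of z] unfolding eventually_at by auto
    then have "F analytic_on ball z d - {z}"
      using F_an by (subst analytic_on_analytic_at) (auto simp: dist_commute)
    then show ?thesis
      using \<open>d > 0\<close> isolated_singularity_at_def by blast
  qed
  (* Near t the square of the difference quotient of the function of L tends to the square of
  its derivative, and the double pole of the function of M has leading coefficient 1. *)
  have F_lim: "\<exists>c. (F \<longlongrightarrow> c) (at t)" if t: "t \<in> M" "t \<notin> L" for t
  proof -
    obtain l where l: "l \<in> L" "t - l \<in> K"
      using K(2) by blast
    define t0 where "t0 = t - l"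
    have t0: "t0 \<in> T" "wp L t = wp L t0"
      using l t LM M.diff_mem[of t l] add_mem_cancel[of l "t - l"] wp_diff_period[of l t]
      by (auto simp: T_def t0_def)
    have "((\<lambda>z. (wp L z - wp L t) / (z - t)) \<longlongrightarrow> wp' t) (at t)"
      using wp_has_deriv[OF t(2)] by (simp add: has_field_derivative_iff)
    then have "((\<lambda>z. ((wp L z - wp L t) / (z - t)) ^ 2 * ((z - t) ^ 2 * wp M z)
        * (\<Prod>s\<in>T - {t0}. (wp L z - wp L s) ^ 2)) \<longlongrightarrow>
        wp' t ^ 2 * 1 * (\<Prod>s\<in>T - {t0}. (wp L t - wp L s) ^ 2)) (at t)"
      using wp_analytic_at[OF t(2)] M.wp_lim_lattice[OF t(1)]
      by (intro tendsto_intros) (auto dest!: analytic_at_imp_isCont simp: isCont_def)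
    moreover have "eventually (\<lambda>z. ((wp L z - wp L t) / (z - t)) ^ 2 * ((z - t) ^ 2 * wp M z)
        * (\<Prod>s\<in>T - {t0}. (wp L z - wp L s) ^ 2) = F z) (at t)"
      by (simp add: eventually_at_filter F_def Q_def prod.remove[OF finT t0(1)] t0(2) power_divide)
    ultimately show ?thesis
      using Lim_transform_eventually by blast
  qed
  have h_eq: "h z = F z" if "z \<notin> M" for z
    using F_an[OF that] by (simp add: h_def)
  have h_an: "h analytic_on {z}" if zL: "z \<notin> L" for z
  proof (cases "z \<in> M")
    case True
    then obtain c where "(F \<longlongrightarrow> c) (at z)"
      using F_lim zL by blast
    then show ?thesis
      unfolding h_def using remove_sings_analytic_at[OF F_iso] by blast
  next
    case False
    then have "(F \<longlongrightarrow> F z) (at z)"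
      using F_an analytic_at_imp_isCont isContD by blast
    then show ?thesis
      unfolding h_def using remove_sings_analytic_at[OF F_iso] by blast
  qed
  have h_hol: "h holomorphic_on - L"
    using h_an by (metis ComplD analytic_imp_holomorphic analytic_on_analytic_at)
  have h_even: "h (- z) = h z" for z
  proof -
    have "filtermap uminus (at z) = at (- z)"
      using filtermap_at_minus[of z] by simp
    then have "remove_sings (F \<circ> uminus) z = remove_sings F (- z)"
      by (rule remove_sings_compose)
    moreover have "F \<circ> uminus = F"
      by (simp add: F_def Q_def fun_eq_iff wp_minus M.wp_minus)
    ultimately show ?thesis
      by (simp add: h_def)
  qed
  have h_per: "h (z + l) = h z" if "l \<in> L" for z l
  proof -
    have "filtermap (\<lambda>z. z + l) (at z) = at (z + l)"
      using filtermap_at_shift[of "- l" z] by simp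
    then have "remove_sings (F \<circ> (\<lambda>z. z + l)) z = remove_sings F (z + l)"
      by (rule remove_sings_compose)
    moreover have "F \<circ> (\<lambda>z. z + l) = F"
      using that LM by (auto simp: F_def Q_def fun_eq_iff wp_add_period M.wp_add_period)
    ultimately show ?thesis
      by (simp add: h_def)
  qed
  have h_lim: "((\<lambda>z. z ^ (2 * (2 * card T + 1)) * h z) \<longlongrightarrow> 1) (at 0)"
  proof (rule Lim_transform_eventually)
    have "((\<lambda>z. (\<Prod>t\<in>T. (z ^ 2 * wp L z - z ^ 2 * wp L t) ^ 2) * (z ^ 2 * wp M z)) \<longlongrightarrow>
        (\<Prod>t\<in>T. (1 - 0 ^ 2 * wp L t) ^ 2) * 1) (at 0)"
      by (intro tendsto_intros wp_lim_0 M.wp_lim_0)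
    then show "((\<lambda>z. (\<Prod>t\<in>T. (z ^ 2 * wp L z - z ^ 2 * wp L t) ^ 2) * (z ^ 2 * wp M z)) \<longlongrightarrow> 1) (at 0)"
      by simp
    show "eventually (\<lambda>z. (\<Prod>t\<in>T. (z ^ 2 * wp L z - z ^ 2 * wp L t) ^ 2) * (z ^ 2 * wp M z) =
        z ^ (2 * (2 * card T + 1)) * h z) (at 0)"
      using M.eventually_at_not_mem[of 0]
    proof eventually_elim
      case (elim z)
      have "(\<Prod>t\<in>T. (z ^ 2 * wp L z - z ^ 2 * wp L t) ^ 2) = (\<Prod>t\<in>T. z ^ 4 * (wp L z - wp L t) ^ 2)"
        by (intro prod.cong refl) (simp add: right_diff_distrib[symmetric] power_mult_distrib)
      also have "\<dots> = z ^ (4 * card T) * Q z"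
        by (simp add: prod.distrib Q_def power_mult)
      finally show ?case
        unfolding h_eq[OF elim] F_def by (simp add: power_add power2_eq_square algebra_simps)
    qed
  qed
  obtain q where q: "\<And>z. z \<notin> L \<Longrightarrow> h z = poly q (wp L z)"
    using even_elliptic_is_polynomial[OF h_hol h_even h_per h_lim] by blast
  define d where "d = (\<Prod>t\<in>T. [:- wp L t, 1:] ^ 2)"
  have d0: "d \<noteq> 0"
    using finT by (simp add: d_def)
  have dQ: "poly d (wp L z) = Q z" for z
    by (simp add: d_def Q_def poly_prod)
  have "poly (denom (Fract q d)) (wp L z) \<noteq> 0 \<and> wp M z = rat_eval (Fract q d) (wp L z)" if z: "z \<notin> M" for z
  proof -
    have zL: "z \<notin> L"
      using z LM by blast
    have "wp L z \<noteq> wp L t" if "t \<in> T" for t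
    proof
      assume "wp L z = wp L t"
      then have "z - t \<in> L \<or> z + t \<in> L"
        using wp_eq_iff[OF zL, of t] that T by blast
      then have "z - t \<in> M \<or> z + t \<in> M"
        using LM by blast
      then show False
        using M.add_mem[of "z - t" t] M.diff_mem[of "z + t" t] that T z by auto
    qed
    then have Qz: "Q z \<noteq> 0"
      using finT by (simp add: Q_def)
    then have "wp M z = poly q (wp L z) / poly d (wp L z)"
      using q[OF zL] h_eq[OF z] dQ by (simp add: F_def field_simps)
    then show ?thesis
      using rat_eval_Fract[OF d0, of "wp L z" q] Qz dQ by simp
  qed
  then show ?thesis
    by blast
qed

lemma lattice2_scale:
  assumes "c \<noteq> 0"
  shows "lattice2 ((*) c ` L)"
proof -
  obtain \<omega>1 \<omega>2 where w: "\<omega>1 \<noteq> \<omega>2" "independent {\<omega>1, \<omega>2}"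
    and L: "L = {of_int a * \<omega>1 + of_int b * \<omega>2 | a b. True}"
    using lattice2 unfolding lattice2_def by blast
  have lin: "linear ((*) c)"
    by (rule linearI) (auto simp: algebra_simps)
  have inj: "inj_on ((*) c) S" for S
    using assms by (auto simp: inj_on_def)
  have "independent ((*) c ` {\<omega>1, \<omega>2})"
    by (rule linear_independent_injective_image[OF lin w(2) inj])
  moreover have "(*) c ` L = {of_int a * (c * \<omega>1) + of_int b * (c * \<omega>2) | a b. True}"
  proof -
    have "c * (of_int a * \<omega>1 + of_int b * \<omega>2) = of_int a * (c * \<omega>1) + of_int b * (c * \<omega>2)" for a b
      by (simp add: algebra_simps)
    then show ?thesis
      unfolding L image_Collect by (metis (no_types, lifting))
  qed
  ultimately show ?thesis
    unfolding lattice2_def using w(1) assms by (intro exI[of _ "c * \<omega>1"] exI[of _ "c * \<omega>2"]) auto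
qed

lemma wp_scale:
  assumes "c \<noteq> 0"
  shows "wp ((*) c ` L) (c * z) = wp L z / c ^ 2"
proof -
  have bij: "bij_betw ((*) c) (L - {0}) ((*) c ` L - {0})"
    using assms by (auto simp: bij_betw_def inj_on_def)
  have "(\<Sum>\<^sub>\<infinity>l\<in>(*) c ` L - {0}. 1 / (c * z - l) ^ 2 - 1 / l ^ 2)
      = (\<Sum>\<^sub>\<infinity>l\<in>L - {0}. 1 / (c * z - c * l) ^ 2 - 1 / (c * l) ^ 2)"
    by (rule infsum_reindex_bij_betw[OF bij, symmetric])
  also have "\<dots> = (\<Sum>\<^sub>\<infinity>l\<in>L - {0}. (1 / c ^ 2) * (1 / (z - l) ^ 2 - 1 / l ^ 2))"
    by (rule infsum_cong) (simp add: right_diff_distrib[symmetric] power_mult_distrib, simp add: diff_divide_distrib mult.commute)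
  also have "\<dots> = (1 / c ^ 2) * (\<Sum>\<^sub>\<infinity>l\<in>L - {0}. 1 / (z - l) ^ 2 - 1 / l ^ 2)"
    by (rule infsum_cmult_right')
  finally show ?thesis
    by (simp add: wp_def power_mult_distrib add_divide_distrib)
qed

text \<open>
  Rescaling reduces this to the inclusion of \<open>L\<close> in the lattice \<open>M/k\<close>.
\<close>

theorem wp_isogeny_rational:
  assumes M: "plane_lattice M" and k: "k \<noteq> 0" and LM: "\<And>l. l \<in> L \<Longrightarrow> k * l \<in> M"
  shows "\<exists>R. \<forall>z. k * z \<notin> M \<longrightarrow> poly (denom R) (wp L z) \<noteq> 0 \<and> wp M (k * z) = rat_eval R (wp L z)"
proof -
  interpret M: plane_lattice M
    by (rule M)
  let ?N = "(*) (1 / k) ` M"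
  have N: "plane_lattice ?N"
    using M.lattice2_scale[of "1 / k"] k by unfold_locales simp
  have memN: "z \<in> ?N \<longleftrightarrow> k * z \<in> M" for z
    using k by (auto simp: image_iff field_simps)
  then obtain R where R: "\<And>z. z \<notin> ?N \<Longrightarrow> poly (denom R) (wp L z) \<noteq> 0 \<and> wp ?N z = rat_eval R (wp L z)"
    using wp_superlattice_rational[OF N] LM by blast
  have scale: "wp M (k * z) = wp ?N z / k ^ 2" for z
    using M.wp_scale[of "1 / k" "k * z"] k by (simp add: field_simps)
  have "poly (denom (rat_const (1 / k ^ 2) * R)) (wp L z) \<noteq> 0 \<and>
      wp M (k * z) = rat_eval (rat_const (1 / k ^ 2) * R) (wp L z)" if "k * z \<notin> M" for z
    using R[of z] that memN scale[of z] rat_eval_mult[OF rat_eval_const(1), of R "wp L z" "1 / k ^ 2"]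
    by (simp add: rat_eval_const)
  then show ?thesis
    by blast
qed

text \<open>
  Existence is the case \<open>k = m\<close>, \<open>M = L\<close> of the preceding theorem. Two candidates agree at all but
  countably many points because \<open>\<wp>\<close> is surjective, so the definite description denotes.
\<close>

lemma mult_ratfun:
  assumes "m > 0" "of_nat m * z \<notin> L"
  shows "poly (denom (mult_ratfun m L)) (wp L z) \<noteq> 0"
    "wp L (of_nat m * z) = rat_eval (mult_ratfun m L) (wp L z)"
proof -
  let ?P = "\<lambda>A. \<forall>z. of_nat m * z \<notin> L \<longrightarrow>
     poly (denom A) (wp L z) \<noteq> 0 \<and> wp L (of_nat m * z) = rat_eval A (wp L z)"
  have "\<exists>A. ?P A"
    by (rule wp_isogeny_rational[OF plane_lattice_axioms]) (use assms(1) of_nat_mult_mem in auto)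
  then obtain A0 where A0: "?P A0"
    by blast
  have uniq: "A = B" if A: "?P A" and B: "?P B" for A B
  proof (rule rat_eval_eqI)
    have "eventually (\<lambda>z. of_nat m * z \<notin> L) cocountable"
      using cocountable_compose_inj[OF cocountable_not_mem, of "(*) (of_nat m)"] assms(1)
      by (simp add: inj_def)
    then have "eventually (\<lambda>x. \<exists>z. z \<notin> L \<and> of_nat m * z \<notin> L \<and> wp L z = x) cocountable"
      by (rule wp_image_cocountable)
    then have "eventually (\<lambda>x. rat_eval A x = rat_eval B x) cocountable"
      by eventually_elim (use A B in metis)
    then show "infinite {x. rat_eval A x = rat_eval B x}"
      by (rule cocountable_imp_infinite)
  qed
  have "mult_ratfun m L = (THE A. ?P A)"
    unfolding mult_ratfun_def rat_eval_def ..
  also have "\<dots> = A0"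
    using A0 uniq by (intro the_equality[where P = ?P]) blast+
  finally have "?P (mult_ratfun m L)"
    using A0 by simp
  then show "poly (denom (mult_ratfun m L)) (wp L z) \<noteq> 0"
    "wp L (of_nat m * z) = rat_eval (mult_ratfun m L) (wp L z)"
    using assms(2) by blast+
qed


section \<open>Semiconjugacy\<close>

lemma wp_avoid: "eventually (\<lambda>z. wp L z \<noteq> c) cocountable"
proof (rule ccontr)
  assume "\<not> ?thesis"
  then have "eventually (\<lambda>z. wp L z = c) cocountable"
    using meromorphic_const_or_avoid_cocountable[OF wp_meromorphic] by blast
  then have "eventually (\<lambda>x. \<exists>z. z \<notin> L \<and> wp L z = c \<and> wp L z = x) cocountable"
    by (rule wp_image_cocountable)
  then have "eventually (\<lambda>x. x = c) cocountable"
    by eventually_elim auto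
  then have "infinite {x. x = c}"
    by (rule cocountable_imp_infinite)
  then show False
    by simp
qed

lemma wp_linear_avoid: "k \<noteq> 0 \<Longrightarrow> eventually (\<lambda>z. wp L (k * z) \<noteq> c) cocountable"
  by (rule cocountable_compose_inj[OF wp_avoid]) (simp add: inj_def)

lemma cocountable_mult_not_mem: "k \<noteq> 0 \<Longrightarrow> eventually (\<lambda>z. k * z \<notin> L) cocountable"
  by (rule cocountable_compose_inj[OF cocountable_not_mem]) (simp add: inj_def)

end

text \<open>
  Let \<open>X\<close> be multiplication by \<open>k\<close> in the coordinates \<open>\<wp>\<^bsub>L\<^esub>\<close> and \<open>\<wp>\<^bsub>M\<^esub>\<close>. Multiplication by \<open>k\<close>
  commutes with multiplication by \<open>m\<close>.
\<close>

lemma semiconjugate_if_isogenous: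
  assumes L: "plane_lattice L" and M: "plane_lattice M" and k: "k \<noteq> 0"
    and LM: "\<And>l. l \<in> L \<Longrightarrow> k * l \<in> M" and m: "m > 0"
  shows "semiconjugate_to (mult_ratfun m L) (mult_ratfun m M)"
proof -
  interpret L: plane_lattice L by (rule L)
  interpret M: plane_lattice M by (rule M)
  obtain X where X: "\<And>z. k * z \<notin> M \<Longrightarrow> wp M (k * z) = rat_eval X (wp L z)"
    using L.wp_isogeny_rational[OF M k LM] by blast
  let ?A = "mult_ratfun m M" and ?B = "mult_ratfun m L"
  have generic: "eventually (\<lambda>z. k * z \<notin> M \<and> of_nat m * (k * z) \<notin> M \<and> of_nat m * z \<notin> L) cocountable"
    using m k M.cocountable_mult_not_mem[of k] M.cocountable_mult_not_mem[of "of_nat m * k"]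
      L.cocountable_mult_not_mem[of "of_nat m"]
    by (auto simp: mult.assoc intro: eventually_conj)
  have "nonconstant X"
  proof (rule ccontr)
    assume "\<not> ?thesis"
    then obtain c where c: "X = rat_const c"
      unfolding nonconstant_def by blast
    have "eventually (\<lambda>z. False) cocountable"
      using M.cocountable_mult_not_mem[OF k] M.wp_linear_avoid[OF k, of c]
      by eventually_elim (simp add: X c rat_eval_const)
    then show False by simp
  qed
  have "nonconstant ?B"
  proof (rule ccontr)
    assume "\<not> ?thesis"
    then obtain c where c: "?B = rat_const c"
      unfolding nonconstant_def by blast
    have m0: "of_nat m \<noteq> (0 :: complex)"
      using m by simp
    have "eventually (\<lambda>z. False) cocountable"
      using L.cocountable_mult_not_mem[OF m0] L.wp_linear_avoid[OF m0, of c]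
      by eventually_elim (simp add: L.mult_ratfun(2)[OF m] c rat_eval_const)
    then show False by simp
  qed
  have "eventually (\<lambda>x. \<exists>z. z \<notin> L \<and> (k * z \<notin> M \<and> of_nat m * (k * z) \<notin> M \<and> of_nat m * z \<notin> L)
      \<and> wp L z = x) cocountable"
    by (rule L.wp_image_cocountable[OF generic])
  then have eq: "eventually (\<lambda>x. rat_eval ?A (rat_eval X x) = rat_eval X (rat_eval ?B x)) cocountable"
  proof eventually_elim
    case (elim x)
    then obtain z where z: "k * z \<notin> M" "of_nat m * (k * z) \<notin> M" "of_nat m * z \<notin> L" "wp L z = x"
      by blast
    have "rat_eval ?A (rat_eval X x) = wp M (of_nat m * (k * z))"
      using X[OF z(1)] M.mult_ratfun(2)[OF m z(2)] z(4) by simp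
    also have "\<dots> = wp M (k * (of_nat m * z))"
      by (simp add: mult.left_commute)
    also have "\<dots> = rat_eval X (rat_eval ?B x)"
      using X[of "of_nat m * z"] z L.mult_ratfun(2)[OF m z(3)] by (simp add: mult.left_commute)
    finally show ?case .
  qed
  have "rat_comp ?A X = rat_comp X ?B"
  proof (rule rat_eval_eqI, rule cocountable_imp_infinite)
    have "eventually (\<lambda>x. rat_eval (rat_comp ?A X) x = rat_eval ?A (rat_eval X x)) cocountable"
      "eventually (\<lambda>x. rat_eval (rat_comp X ?B) x = rat_eval X (rat_eval ?B x)) cocountable"
      using rat_eval_comp[OF \<open>nonconstant X\<close>] rat_eval_comp[OF \<open>nonconstant ?B\<close>]
      by (simp_all add: eventually_cocountable countable_finite)
    with eq show "eventually (\<lambda>x. rat_eval (rat_comp ?A X) x = rat_eval (rat_comp X ?B) x) cocountable"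
      by eventually_elim simp
  qed
  then show ?thesis
    unfolding semiconjugate_to_def using \<open>nonconstant X\<close> by blast
qed

section \<open>Uniformizations and elementary transformations\<close>

text \<open>
  For \<open>g = \<wp>\<^bsub>L\<^esub>\<close> and \<open>M = L\<close> the description of the fibres holds at all points that are not poles.
  For the other functions in a chain it is only available at general points, and only these are
  needed to recover \<open>M\<close> as the group of periods of \<open>g\<close>.
\<close>

definition uniformizes :: "nat \<Rightarrow> ratfun \<Rightarrow> (complex \<Rightarrow> complex) \<Rightarrow> complex set \<Rightarrow> bool" where
  "uniformizes m B g M \<longleftrightarrow>
     g meromorphic_on UNIV \<and>
     (\<forall>\<^sub>F z in cocountable. g (- z) = g z) \<and>
     (\<forall>\<^sub>F z in cocountable. g (of_nat m * z) = rat_eval B (g z)) \<and>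
     0 \<in> M \<and> (\<forall>s\<in>M. \<forall>t\<in>M. s - t \<in> M) \<and> countable M \<and>
     (\<exists>E. countable E \<and> (\<forall>z w. z \<notin> E \<longrightarrow> w \<notin> E \<longrightarrow> (g z = g w \<longleftrightarrow> z - w \<in> M \<or> z + w \<in> M)))"

lemma (in plane_lattice) wp_uniformizes:
  assumes "m > 0"
  shows "uniformizes m (mult_ratfun m L) (wp L) L"
  unfolding uniformizes_def
proof (intro conjI)
  show "\<forall>\<^sub>F z in cocountable. wp L (of_nat m * z) = rat_eval (mult_ratfun m L) (wp L z)"
    using cocountable_mult_not_mem[of "of_nat m"] assms
    by (auto elim!: eventually_mono simp: mult_ratfun)
  show "\<exists>E. countable E \<and> (\<forall>z w. z \<notin> E \<longrightarrow> w \<notin> E \<longrightarrow> (wp L z = wp L w \<longleftrightarrow> z - w \<in> L \<or> z + w \<in> L))"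
    using countable_lattice wp_eq_iff by blast
qed (auto simp: wp_meromorphic wp_minus countable_lattice intro: diff_mem)

lemma cocountable_affine:
  assumes "eventually P cocountable" "a \<noteq> 0"
  shows "eventually (\<lambda>z. P (a * z + b)) cocountable"
  by (rule cocountable_compose_inj[OF assms(1), of "\<lambda>z. a * z + b"]) (use assms(2) in \<open>simp add: inj_def\<close>)

lemma cocountable_notin: "countable E \<Longrightarrow> eventually (\<lambda>z. z \<notin> E) cocountable"
  by (simp add: eventually_cocountable)

lemma cocountable_exists: "eventually P cocountable \<Longrightarrow> \<exists>z. P z"
  using cocountable_neq_bot eventually_happens' by blast

locale uniformization =
  fixes m :: nat and B g M
  assumes m_pos: "m > 0" and uniformizes: "uniformizes m B g M"
begin

lemma mero: "g meromorphic_on UNIV"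
  and even: "\<forall>\<^sub>F z in cocountable. g (- z) = g z"
  and mult: "\<forall>\<^sub>F z in cocountable. g (of_nat m * z) = rat_eval B (g z)"
  and M_zero: "0 \<in> M" and M_diff: "s \<in> M \<Longrightarrow> t \<in> M \<Longrightarrow> s - t \<in> M" and M_countable: "countable M"
proof -
  note u = uniformizes[unfolded uniformizes_def]
  show "g meromorphic_on UNIV"
    by (rule u[THEN conjunct1])
  show "\<forall>\<^sub>F z in cocountable. g (- z) = g z"
    by (rule u[THEN conjunct2, THEN conjunct1])
  show "\<forall>\<^sub>F z in cocountable. g (of_nat m * z) = rat_eval B (g z)"
    by (rule u[THEN conjunct2, THEN conjunct2, THEN conjunct1])
  note v = u[THEN conjunct2, THEN conjunct2, THEN conjunct2]
  show "0 \<in> M"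
    by (rule v[THEN conjunct1])
  show "s \<in> M \<Longrightarrow> t \<in> M \<Longrightarrow> s - t \<in> M"
    by (rule v[THEN conjunct2, THEN conjunct1, rule_format])
  show "countable M"
    by (rule v[THEN conjunct2, THEN conjunct2, THEN conjunct1])
qed

definition exceptional :: "complex set" where
  "exceptional = (SOME E. countable E \<and>
     (\<forall>z w. z \<notin> E \<longrightarrow> w \<notin> E \<longrightarrow> (g z = g w \<longleftrightarrow> z - w \<in> M \<or> z + w \<in> M)))"

lemma exceptional: "countable exceptional"
  "z \<notin> exceptional \<Longrightarrow> w \<notin> exceptional \<Longrightarrow> g z = g w \<longleftrightarrow> z - w \<in> M \<or> z + w \<in> M"
proof -
  have "\<exists>E. countable E \<and> (\<forall>z w. z \<notin> E \<longrightarrow> w \<notin> E \<longrightarrow> (g z = g w \<longleftrightarrow> z - w \<in> M \<or> z + w \<in> M))"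
    by (rule uniformizes[unfolded uniformizes_def, THEN conjunct2, THEN conjunct2, THEN conjunct2,
          THEN conjunct2, THEN conjunct2, THEN conjunct2])
  from someI_ex[OF this] show "countable exceptional"
    "z \<notin> exceptional \<Longrightarrow> w \<notin> exceptional \<Longrightarrow> g z = g w \<longleftrightarrow> z - w \<in> M \<or> z + w \<in> M"
    unfolding exceptional_def by blast+
qed

lemma generic_affine_notin:
  assumes "countable E" "a \<noteq> 0"
  shows "\<forall>\<^sub>F z in cocountable. a * z + b \<notin> E"
  by (rule cocountable_affine[OF cocountable_notin[OF assms(1)] assms(2)])

lemma avoid: "\<forall>\<^sub>F z in cocountable. g z \<noteq> c"
proof (rule ccontr)
  assume "\<not> ?thesis"
  then have const: "\<forall>\<^sub>F z in cocountable. g z = c"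
    using meromorphic_const_or_avoid_cocountable[OF mero] by blast
  then have "\<forall>\<^sub>F z in cocountable. g z = c \<and> z \<notin> exceptional"
    using cocountable_notin[OF exceptional(1)] by (rule eventually_conj)
  then obtain w where w: "g w = c" "w \<notin> exceptional"
    using cocountable_exists by blast
  have "\<forall>\<^sub>F z in cocountable. False"
    using const cocountable_notin[OF exceptional(1)]
      generic_affine_notin[OF M_countable one_neq_zero, of "- w"]
      generic_affine_notin[OF M_countable one_neq_zero, of w]
    by eventually_elim (use w exceptional(2)[of _ w] in auto)
  then show False by simp
qed

lemma avoid_finite: "finite S \<Longrightarrow> \<forall>\<^sub>F z in cocountable. g z \<notin> S"
proof -
  assume "finite S"
  then have "\<forall>\<^sub>F z in cocountable. \<forall>c\<in>S. g z \<noteq> c"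
    by (intro cocountable_ball countable_finite avoid)
  then show ?thesis
    by eventually_elim auto
qed

lemma nonconstant_B: "nonconstant B"
proof (rule ccontr)
  assume "\<not> ?thesis"
  then obtain c where c: "B = rat_const c"
    unfolding nonconstant_def by blast
  have "\<forall>\<^sub>F z in cocountable. g (of_nat m * z + 0) \<noteq> c"
    by (rule cocountable_affine[OF avoid]) (use m_pos in auto)
  with mult have "\<forall>\<^sub>F z in cocountable. False"
    by eventually_elim (simp add: c rat_eval_const)
  then show False by simp
qed

text \<open>
  For \<open>B = U \<circ> V\<close> the new function is \<open>g' = V \<circ> g\<close>, with its full group of periods. Since
  \<open>U(g'(z)) = g(mz)\<close>, two points with the same value under \<open>g'\<close> differ, up to sign, by some \<open>t\<close> with
  \<open>m t \<in> M\<close>. There are countably many such \<open>t\<close>, and for each of them the relation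
  \<open>g'(z + t) = g'(z)\<close> either holds identically or fails at general points. So at general points the
  fibres of \<open>g'\<close> come from periods only.
\<close>

lemma elementary_step:
  assumes "elementary_transformation B B'"
  shows "\<exists>g' M'. uniformizes m B' g' M' \<and> M \<subseteq> M' \<and> (\<forall>t\<in>M'. of_nat m * t \<in> M)"
proof -
  obtain U V where UV: "B = rat_comp U V" "B' = rat_comp V U"
    using assms unfolding elementary_transformation_def by blast
  have U: "nonconstant U" and V: "nonconstant V"
    using nonconstant_B nonconstant_rat_comp unfolding UV by blast+
  have m0: "of_nat m \<noteq> (0 :: complex)"
    using m_pos by simp
  then have m2: "2 * of_nat m \<noteq> (0 :: complex)"
    by simp
  define g' where "g' z = rat_eval V (g z)" for z
  define M' where "M' = {t. \<forall>\<^sub>F z in cocountable. g' (z + t) = g' z}"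
  have mero': "g' meromorphic_on UNIV"
    unfolding g'_def by (rule meromorphic_on_rat_eval[OF mero])
  have even': "\<forall>\<^sub>F z in cocountable. g' (- z) = g' z"
    using even by eventually_elim (simp add: g'_def)
  have U_g': "\<forall>\<^sub>F z in cocountable. g (of_nat m * z) = rat_eval U (g' z)"
    using mult avoid_finite[OF rat_eval_comp[OF V, of U]]
    by eventually_elim (auto simp: g'_def UV)
  have "finite {x. rat_eval V x \<in> {y. rat_eval (rat_comp V U) y \<noteq> rat_eval V (rat_eval U y)}}"
    by (rule finite_rat_eval_vimage[OF V rat_eval_comp[OF U]])
  then have "\<forall>\<^sub>F z in cocountable. g z \<notin> {x. rat_eval V x \<in> {y. rat_eval (rat_comp V U) y \<noteq> rat_eval V (rat_eval U y)}}"
    by (rule avoid_finite)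
  with U_g' have mult': "\<forall>\<^sub>F z in cocountable. g' (of_nat m * z) = rat_eval B' (g' z)"
    by eventually_elim (simp add: UV g'_def)
  have M'_zero: "0 \<in> M'"
    by (simp add: M'_def)
  have M'_diff: "s - t \<in> M'" if "s \<in> M'" "t \<in> M'" for s t
  proof -
    have "\<forall>\<^sub>F z in cocountable. g' (1 * z + (- t) + s) = g' (1 * z + (- t))"
      "\<forall>\<^sub>F z in cocountable. g' (1 * z + (- t) + t) = g' (1 * z + (- t))"
      using that cocountable_affine[OF _ one_neq_zero, of "\<lambda>z. g' (z + s) = g' z" "- t"]
        cocountable_affine[OF _ one_neq_zero, of "\<lambda>z. g' (z + t) = g' z" "- t"]
      unfolding M'_def by simp_all
    then have "\<forall>\<^sub>F z in cocountable. g' (z + (s - t)) = g' z"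
      by eventually_elim (simp add: algebra_simps)
    then show ?thesis
      by (simp add: M'_def)
  qed
  have sub: "M \<subseteq> M'"
  proof
    fix t assume t: "t \<in> M"
    have "\<forall>\<^sub>F z in cocountable. g' (z + t) = g' z"
      using generic_affine_notin[OF exceptional(1) one_neq_zero, of 0]
        generic_affine_notin[OF exceptional(1) one_neq_zero, of t]
    proof eventually_elim
      case (elim z)
      then have "g (z + t) = g z"
        using t exceptional(2)[of "z + t" z] by simp
      then show ?case
        by (simp add: g'_def)
    qed
    then show "t \<in> M'"
      by (simp add: M'_def)
  qed
  (* The fibre of g allows a second alternative, with the sum of the two points in place of
  their difference; it fails for general z because M is countable. *)
  have mM': "of_nat m * t \<in> M" if "t \<in> M'" for t
  proof -
    have "\<forall>\<^sub>F z in cocountable. g' (z + t) = g' z"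
      using that by (simp add: M'_def)
    moreover have "\<forall>\<^sub>F z in cocountable. g (of_nat m * (1 * z + t)) = rat_eval U (g' (1 * z + t))"
      by (rule cocountable_affine[OF U_g']) simp
    moreover note U_g' generic_affine_notin[OF exceptional(1) m0, of 0]
      generic_affine_notin[OF exceptional(1) m0, of "of_nat m * t"]
      generic_affine_notin[OF M_countable m2, of "of_nat m * t"]
    ultimately have "\<forall>\<^sub>F z in cocountable. of_nat m * t \<in> M"
    proof (eventually_elim, goal_cases)
      case (1 z)
      then have "g (of_nat m * z + of_nat m * t) = g (of_nat m * z)"
        by (simp add: distrib_left)
      then have "of_nat m * z + of_nat m * t - of_nat m * z \<in> M \<or> of_nat m * z + of_nat m * t + of_nat m * z \<in> M"
        using exceptional(2)[of "of_nat m * z + of_nat m * t" "of_nat m * z"] 1 by simp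
      then show ?case
        using 1 by (auto simp: algebra_simps)
    qed
    then show ?thesis
      by simp
  qed
  define N where "N = {t. of_nat m * t \<in> M}"
  have N_countable: "countable N"
  proof -
    have "N = (*) (1 / of_nat m) ` M"
      using m0 by (auto simp: N_def image_iff intro!: bexI[of _ "of_nat m * _"])
    then show ?thesis
      using M_countable by simp
  qed
  have M'N: "M' \<subseteq> N"
    using mM' by (auto simp: N_def)
  have "\<forall>\<^sub>F z in cocountable. g' (z + t) = g' z \<longleftrightarrow> t \<in> M'" for t
  proof (cases "t \<in> M'")
    case False
    have "(\<lambda>z. g' (1 * z + t)) meromorphic_on UNIV"
      by (rule meromorphic_on_affine[OF mero'])
    then show ?thesis
      using meromorphic_eq_or_neq_cocountable[OF _ mero', of "\<lambda>z. g' (1 * z + t)"] False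
      by (auto simp: M'_def elim!: eventually_mono)
  qed (auto simp: M'_def)
  then have period: "\<forall>\<^sub>F z in cocountable. \<forall>t\<in>N. g' (z + t) = g' z \<longleftrightarrow> t \<in> M'"
    by (intro cocountable_ball N_countable)
  (* A good point obeys all generic relations at once. In the fibre computation both w and -w
  have to be good, since the second alternative is reduced to the first by evenness. *)
  define good where "good z \<longleftrightarrow> (\<forall>t\<in>N. g' (z + t) = g' z \<longleftrightarrow> t \<in> M') \<and>
    g (of_nat m * z) = rat_eval U (g' z) \<and> of_nat m * z \<notin> exceptional \<and> g' (- z) = g' z" for z
  have good: "\<forall>\<^sub>F z in cocountable. good z"
    using period U_g' even' generic_affine_notin[OF exceptional(1) m0, of 0]
    by (auto simp: good_def intro!: eventually_conj)
  have "\<forall>\<^sub>F z in cocountable. good z \<and> good (- 1 * z + 0)"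
    by (rule eventually_conj[OF good cocountable_affine[OF good]]) simp
  then have E: "countable {z. \<not> (good z \<and> good (- z))}"
    by (simp add: eventually_cocountable)
  have fibre: "g' z = g' w \<longleftrightarrow> z - w \<in> M' \<or> z + w \<in> M'"
    if z: "good z" and w: "good w" "good (- w)" for z w
  proof
    assume eq: "g' z = g' w"
    then have "g (of_nat m * z) = g (of_nat m * w)"
      using z w by (simp add: good_def)
    then have "of_nat m * z - of_nat m * w \<in> M \<or> of_nat m * z + of_nat m * w \<in> M"
      using exceptional(2)[of "of_nat m * z" "of_nat m * w"] z w by (simp add: good_def)
    then consider "z - w \<in> N" | "z + w \<in> N"
      by (auto simp: N_def algebra_simps)
    then show "z - w \<in> M' \<or> z + w \<in> M'"
    proof cases
      case 1
      then show ?thesis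
        using w(1) eq unfolding good_def by (metis add.commute diff_add_cancel)
    next
      case 2
      then have "g' (- w + (z + w)) = g' (- w) \<longleftrightarrow> z + w \<in> M'"
        using w(2) unfolding good_def by blast
      then show ?thesis
        using w(1) eq unfolding good_def by simp
    qed
  next
    assume "z - w \<in> M' \<or> z + w \<in> M'"
    then consider "z - w \<in> M'" | "z + w \<in> M'"
      by blast
    then show "g' z = g' w"
    proof cases
      case 1
      then have "g' (w + (z - w)) = g' w"
        using w(1) M'N unfolding good_def by blast
      then show ?thesis by simp
    next
      case 2
      then have "g' (- w + (z + w)) = g' (- w)"
        using w(2) M'N unfolding good_def by blast
      then show ?thesis
        using w(1) by (simp add: good_def)
    qed
  qed
  have "uniformizes m B' g' M'"
    unfolding uniformizes_def
    using mero' even' mult' M'_zero M'_diff countable_subset[OF M'N N_countable] E fibre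
    by (intro conjI exI[of _ "{z. \<not> (good z \<and> good (- z))}"]) auto
  then show ?thesis
    using sub mM' by blast
qed

end

lemma rat_equiv_uniformizes:
  assumes "rat_equiv B0 B" "uniformizes m B0 g0 M0" "m > 0"
  shows "\<exists>g M. uniformizes m B g M \<and> M0 \<subseteq> M \<and> (\<forall>t\<in>M. \<exists>j. of_nat (m ^ j) * t \<in> M0)"
  using assms(1) unfolding rat_equiv_def
proof (induction rule: rtranclp_induct)
  case base
  have "of_nat (m ^ 0) * t \<in> M0" if "t \<in> M0" for t
    using that by simp
  then show ?case
    using assms(2) by blast
next
  case (step B B')
  then obtain g M where gM: "uniformizes m B g M" "M0 \<subseteq> M" "\<And>t. t \<in> M \<Longrightarrow> \<exists>j. of_nat (m ^ j) * t \<in> M0"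
    by blast
  interpret uniformization m B g M
    using gM(1) assms(3) by unfold_locales
  obtain g' M' where g': "uniformizes m B' g' M'" "M \<subseteq> M'" "\<And>t. t \<in> M' \<Longrightarrow> of_nat m * t \<in> M"
    using elementary_step[OF step(2)] by blast
  have "\<exists>j. of_nat (m ^ j) * t \<in> M0" if t: "t \<in> M'" for t
  proof -
    obtain j where "of_nat (m ^ j) * (of_nat m * t) \<in> M0"
      using gM(3)[OF g'(3)[OF t]] by blast
    then have "of_nat (m ^ Suc j) * t \<in> M0"
      by (simp add: algebra_simps)
    then show ?thesis
      by blast
  qed
  then show ?case
    using g' gM(2) by blast
qed

section \<open>Lifts that commute with an expansion\<close>

lemma continuous_eq_cocountable:
  assumes "open S" "continuous_on S f" "continuous_on S g"
    and eq: "\<forall>\<^sub>F z in cocountable. z \<in> S \<longrightarrow> f z = (g z :: complex)" and "z \<in> S"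
  shows "f z = g z"
proof (rule ccontr)
  assume ne: "f z \<noteq> g z"
  define T where "T = {w \<in> S. f w - g w \<noteq> 0}"
  have "open (S \<inter> (\<lambda>w. f w - g w) -` (- {0}))"
    using assms(1-3) by (intro continuous_open_preimage continuous_intros) auto
  also have "S \<inter> (\<lambda>w. f w - g w) -` (- {0}) = T"
    by (auto simp: T_def)
  finally have "open T" .
  moreover have "T \<noteq> {}"
    using ne \<open>z \<in> S\<close> by (auto simp: T_def)
  ultimately have "\<exists>w\<in>T. w \<in> S \<longrightarrow> f w = g w"
    using cocountable_exists_in_open[OF eq] by blast
  then show False
    by (auto simp: T_def)
qed

text \<open>
  The coefficient of \<open>z\<^sup>n\<close> satisfies \<open>\<kappa>\<^sup>n c = \<mu> c\<close>, and \<open>|\<kappa>|\<^sup>n = |\<mu>|\<close> only for \<open>n = 1\<close>.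
\<close>

lemma equivariant_imp_linear:
  assumes H: "H holomorphic_on ball 0 \<delta>" "\<delta> > 0" "H 0 = 0"
    and \<kappa>: "norm \<kappa> > 1" "norm \<kappa> = norm \<mu>"
    and eq: "\<And>z. z \<in> ball 0 (\<delta> / norm \<kappa>) \<Longrightarrow> H (\<kappa> * z) = \<mu> * H z"
  shows "\<exists>a. \<forall>z\<in>ball 0 \<delta>. H z = a * z"
proof -
  let ?B = "ball (0::complex) (\<delta> / norm \<kappa>)"
  have \<kappa>0: "norm \<kappa> > 0"
    using \<kappa> by linarith
  have sub: "?B \<subseteq> ball 0 \<delta>"
    using \<kappa>(1) \<kappa>0 H(2) divide_left_mono[of 1 "norm \<kappa>" \<delta>] by (intro subset_ball) simp
  have in_ball: "\<kappa> * z \<in> ball 0 \<delta>" if "z \<in> ball 0 (\<delta> / norm \<kappa>)" for z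
    using that \<kappa>0 by (simp add: norm_mult field_simps)
  have zero: "0 \<in> ball (0::complex) (\<delta> / norm \<kappa>)"
    using H(2) \<kappa>0 by simp
  have deriv0: "(deriv ^^ n) H 0 = 0" if n: "n \<noteq> 1" for n
  proof (cases "n = 0")
    case False
    have "\<kappa> ^ n * (deriv ^^ n) H (\<kappa> * 0) = (deriv ^^ n) (\<lambda>z. H (\<kappa> * z)) 0"
      by (rule higher_deriv_compose_linear[OF H(1) open_ball open_ball zero, symmetric]) (rule in_ball)
    also have "\<dots> = (deriv ^^ n) (\<lambda>z. \<mu> * H z) 0"
    proof (rule higher_deriv_transform_within_open[OF _ _ open_ball zero eq])
      show "(\<lambda>z. H (\<kappa> * z)) holomorphic_on ball 0 (\<delta> / norm \<kappa>)"
        using in_ball by (intro holomorphic_on_compose_gen[OF _ H(1), unfolded o_def] holomorphic_intros) auto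
      show "(\<lambda>z. \<mu> * H z) holomorphic_on ball 0 (\<delta> / norm \<kappa>)"
        by (intro holomorphic_intros holomorphic_on_subset[OF H(1) sub])
    qed
    also have "\<dots> = \<mu> * (deriv ^^ n) H 0"
      using H(2) by (intro higher_deriv_cmult[OF H(1)]) auto
    finally have "\<kappa> ^ n * (deriv ^^ n) H 0 = \<mu> * (deriv ^^ n) H 0"
      by simp
    moreover have "\<kappa> ^ n \<noteq> \<mu>"
    proof
      assume "\<kappa> ^ n = \<mu>"
      then have "norm \<kappa> ^ n = norm \<kappa> ^ 1"
        using \<kappa>(2) by (metis norm_power power_one_right)
      then show False
        using power_inject_exp[OF \<kappa>(1)] n by blast
    qed
    ultimately show ?thesis
      by simp
  qed (simp add: H(3))
  have "H z = (deriv ^^ 1) H 0 * z" if z: "z \<in> ball 0 \<delta>" for z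
  proof (rule holomorphic_fun_eq_on_ball[OF H(1) _ z])
    show "(*) ((deriv ^^ 1) H 0) holomorphic_on ball 0 \<delta>"
      by (intro holomorphic_intros)
    fix n
    have "(deriv ^^ n) (\<lambda>z. (deriv ^^ 1) H 0 * z) 0 = (deriv ^^ 1) H 0 * (deriv ^^ n) (\<lambda>z. z) 0"
      using H(2) by (intro higher_deriv_cmult[of _ "ball 0 \<delta>"]) auto
    then show "(deriv ^^ n) H 0 = (deriv ^^ n) ((*) ((deriv ^^ 1) H 0)) 0"
      using deriv0[of n] by (cases "n = 1") (auto simp: higher_deriv_ident)
  qed
  then show ?thesis
    by blast
qed

text \<open>
  The lift is \<open>H = f\<^sup>-\<^sup>1 \<circ> g\<close>. The relation between \<open>f\<close> and \<open>g\<close> says that \<open>H(\<kappa> z) = \<mu> H(z)\<close>, first at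
  general points and then everywhere by continuity.
\<close>

lemma linear_lift:
  assumes f: "f holomorphic_on ball 0 r" "inj_on f (ball 0 r)" "r > 0"
    and g: "g holomorphic_on ball 0 r" "g 0 = f 0"
    and \<kappa>: "norm \<kappa> > 1" "norm \<kappa> = norm \<mu>"
    and rel: "\<forall>\<^sub>F z in cocountable. \<forall>u. z \<in> ball 0 r \<longrightarrow> \<kappa> * z \<in> ball 0 r \<longrightarrow> u \<in> ball 0 r \<longrightarrow> \<mu> * u \<in> ball 0 r
      \<longrightarrow> g z = f u \<longrightarrow> g (\<kappa> * z) = f (\<mu> * u)"
  obtains a \<epsilon> where "\<epsilon> > 0" "\<And>z. z \<in> ball 0 \<epsilon> \<Longrightarrow> a * z \<in> ball 0 r \<and> g z = f (a * z)"
proof -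
  have \<kappa>0: "norm \<kappa> > 0" "norm \<mu> > 1"
    using \<kappa> by linarith+
  have "\<mu> \<noteq> 0"
    using \<kappa>0(2) by auto
  define s where "s = r / norm \<mu>"
  have s: "s > 0" "ball 0 s \<subseteq> ball (0::complex) r"
    using \<kappa>0(2) \<open>\<mu> \<noteq> 0\<close> f(3) divide_left_mono[of 1 "norm \<mu>" r] by (auto simp: s_def intro!: subset_ball)
  have s_mult: "\<mu> * u \<in> ball 0 r" if "u \<in> ball 0 s" for u
    using that \<kappa>0 \<open>\<mu> \<noteq> 0\<close> by (simp add: s_def norm_mult field_simps)
  obtain k where k: "k holomorphic_on f ` ball 0 r" "\<And>z. z \<in> ball 0 r \<Longrightarrow> k (f z) = z"
    using holomorphic_has_inverse[OF f(1) open_ball f(2)] by metis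
  have "open (f ` ball 0 s)"
    using f s by (intro open_mapping_thm3 holomorphic_on_subset[OF f(1)] inj_on_subset[OF f(2)]) auto
  moreover have "isCont g 0"
    using g(1) f(3) by (metis centre_in_ball continuous_on_eq_continuous_at holomorphic_on_imp_continuous_on open_ball)
  moreover have "g 0 \<in> f ` ball 0 s"
    using g(2) s by auto
  ultimately have "\<forall>\<^sub>F z in nhds 0. g z \<in> f ` ball 0 s"
    by (auto simp: isCont_def tendsto_at_iff_tendsto_nhds topological_tendstoD)
  then obtain d where d: "d > 0" "\<And>z. dist z 0 < d \<Longrightarrow> g z \<in> f ` ball 0 s"
    unfolding eventually_nhds_metric by blast
  define \<delta> where "\<delta> = min d r"
  have \<delta>: "\<delta> > 0" "ball 0 \<delta> \<subseteq> ball (0::complex) r"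
    using d f(3) by (auto simp: \<delta>_def intro!: subset_ball)
  have g_in: "g z \<in> f ` ball 0 s" if "z \<in> ball 0 \<delta>" for z
    using that d(2) by (simp add: \<delta>_def)
  define H where "H z = k (g z)" for z
  have H_ball: "H z \<in> ball 0 s" and fH: "f (H z) = g z" if "z \<in> ball 0 \<delta>" for z
    using g_in[OF that] k(2) s(2) by (auto simp: H_def)
  have H_hol: "H holomorphic_on ball 0 \<delta>"
    unfolding H_def
    by (rule holomorphic_on_compose_gen[OF holomorphic_on_subset[OF g(1) \<delta>(2)] k(1), unfolded o_def])
      (use g_in s(2) in blast)
  have H0: "H 0 = 0"
    using g(2) k(2) f(3) by (simp add: H_def)
  let ?B = "ball (0::complex) (\<delta> / norm \<kappa>)"
  have in_ball: "z \<in> ball 0 \<delta>" "\<kappa> * z \<in> ball 0 \<delta>" if "z \<in> ?B" for z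
  proof -
    have *: "norm z * norm \<kappa> < \<delta>"
      using that \<kappa>0 by (simp add: field_simps)
    then show "\<kappa> * z \<in> ball 0 \<delta>"
      by (simp add: norm_mult mult.commute)
    have "norm z * 1 \<le> norm z * norm \<kappa>"
      using \<kappa> by (intro mult_left_mono) auto
    then show "z \<in> ball 0 \<delta>"
      using * by simp
  qed
  have generic: "\<forall>\<^sub>F z in cocountable. z \<in> ?B \<longrightarrow> H (\<kappa> * z) = \<mu> * H z"
    using rel
  proof eventually_elim
    case (elim z)
    show ?case
    proof
      assume z: "z \<in> ?B"
      have "z \<in> ball 0 r" "\<kappa> * z \<in> ball 0 r"
        using in_ball[OF z] subsetD[OF \<delta>(2)] by simp_all
      moreover have "H z \<in> ball 0 r"
        using H_ball[OF in_ball(1)[OF z]] s(2) by (rule subsetD[rotated])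
      moreover have "\<mu> * H z \<in> ball 0 r"
        by (rule s_mult[OF H_ball[OF in_ball(1)[OF z]]])
      moreover have "g z = f (H z)"
        by (rule fH[OF in_ball(1)[OF z], symmetric])
      ultimately have "\<mu> * H z \<in> ball 0 r" "g (\<kappa> * z) = f (\<mu> * H z)"
        using elim by blast+
      then show "H (\<kappa> * z) = \<mu> * H z"
        using k(2) \<open>\<mu> * H z \<in> ball 0 r\<close> by (simp add: H_def)
    qed
  qed
  have "H (\<kappa> * z) = \<mu> * H z" if z: "z \<in> ?B" for z
  proof (rule continuous_eq_cocountable[OF open_ball _ _ generic z])
    show "continuous_on ?B (\<lambda>z. H (\<kappa> * z))"
      using in_ball by (intro continuous_on_compose2[OF holomorphic_on_imp_continuous_on[OF H_hol]]
          continuous_intros) auto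
    show "continuous_on ?B (\<lambda>z. \<mu> * H z)"
      using in_ball by (intro continuous_intros continuous_on_subset[OF holomorphic_on_imp_continuous_on[OF H_hol]]) auto
  qed
  then obtain a where a: "\<And>z. z \<in> ball 0 \<delta> \<Longrightarrow> H z = a * z"
    using equivariant_imp_linear[OF H_hol \<delta>(1) H0 \<kappa>] by blast
  show ?thesis
  proof (rule that[OF \<delta>(1)])
    fix z :: complex assume "z \<in> ball 0 \<delta>"
    then show "a * z \<in> ball 0 r \<and> g z = f (a * z)"
      using a H_ball fH s(2) by (metis subsetD)
  qed
qed

text \<open>
  Only even powers occur in the Taylor series of \<open>f\<close>. Evaluating it at a square root of \<open>s\<close> gives a
  power series in \<open>s\<close>.
\<close>

lemma even_holomorphic_factor:
  assumes f: "f holomorphic_on ball 0 r" and even: "\<And>z. z \<in> ball 0 r \<Longrightarrow> f (- z) = f z" and r: "r > 0"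
  obtains F where "F holomorphic_on ball 0 (r ^ 2)" "\<And>z. z \<in> ball 0 r \<Longrightarrow> f z = F (z ^ 2)"
proof -
  define F where "F s = f (csqrt s)" for s
  (* The value F s does not depend on the branch of the root, because f is even. *)
  define a where "a n = (deriv ^^ n) f 0 / fact n" for n
  have odd: "a n = 0" if "odd n" for n
  proof -
    have z: "0 \<in> ball (0::complex) r"
      using r by simp
    have "(deriv ^^ n) f 0 = (deriv ^^ n) (\<lambda>z. f (- 1 * z)) 0"
      by (rule higher_deriv_transform_within_open[OF f _ open_ball z])
        (use even in \<open>auto intro!: holomorphic_on_compose_gen[OF _ f, unfolded o_def] holomorphic_intros\<close>)
    also have "\<dots> = (- 1) ^ n * (deriv ^^ n) f (- 1 * 0)"
      by (rule higher_deriv_compose_linear[OF f open_ball open_ball z]) auto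
    finally show ?thesis
      using that by (simp add: a_def)
  qed
  have "(\<lambda>k. a (2 * k) * (s - 0) ^ k) sums F s" if "s \<in> ball 0 (r ^ 2)" for s
  proof -
    have "norm (csqrt s) ^ 2 < r ^ 2"
      using that by (simp add: norm_power[symmetric])
    then have "norm (csqrt s) < r"
      using r by (simp add: power2_less_imp_less)
    then have "(\<lambda>n. a n * csqrt s ^ n) sums F s"
      using holomorphic_power_series[OF f, of "csqrt s"] by (simp add: a_def F_def)
    moreover have "(\<lambda>k. (\<lambda>n. a n * csqrt s ^ n) (2 * k)) sums F s \<longleftrightarrow> (\<lambda>n. a n * csqrt s ^ n) sums F s"
    proof (rule sums_mono_reindex)
      show "strict_mono ((*) (2::nat))"
        by (simp add: strict_mono_def)
      fix n :: nat assume "n \<notin> range ((*) 2)"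
      then have "odd n"
        by (auto elim: evenE)
      then show "a n * csqrt s ^ n = 0"
        by (simp add: odd)
    qed
    ultimately show ?thesis
      by (simp add: power_mult)
  qed
  then have "F holomorphic_on ball 0 (r ^ 2)"
    by (rule power_series_holomorphic)
  moreover have "f z = F (z ^ 2)" if "z \<in> ball 0 r" for z
  proof -
    have "csqrt (z ^ 2) = z \<or> csqrt (z ^ 2) = - z"
      by (metis power2_csqrt power2_eq_iff)
    then show ?thesis
      using even[OF that] by (auto simp: F_def)
  qed
  ultimately show ?thesis
    by (rule that)
qed

text \<open>
  Both functions factor through \<open>z\<^sup>2\<close>. The factor of \<open>f\<close> is injective, and multiplication by \<open>\<kappa>\<close>
  becomes multiplication by \<open>\<kappa>\<^sup>2\<close>. A linear relation between the squares is a linear relation between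
  the original variables.
\<close>

lemma linear_lift_even:
  assumes f: "f holomorphic_on ball 0 r" "r > 0" "\<And>u v. u \<in> ball 0 r \<Longrightarrow> v \<in> ball 0 r \<Longrightarrow> f u = f v \<longleftrightarrow> u = v \<or> u = - v"
    and g: "g holomorphic_on ball 0 r" "g 0 = f 0" "\<And>z. z \<in> ball 0 r \<Longrightarrow> g (- z) = g z"
    and \<kappa>: "norm \<kappa> > 1"
    and rel: "\<forall>\<^sub>F z in cocountable. \<forall>u. z \<in> ball 0 r \<longrightarrow> \<kappa> * z \<in> ball 0 r \<longrightarrow> u \<in> ball 0 r \<longrightarrow> \<kappa> * u \<in> ball 0 r
      \<longrightarrow> g z = f u \<longrightarrow> g (\<kappa> * z) = f (\<kappa> * u)"
  obtains a \<epsilon> where "\<epsilon> > 0" "\<And>z. z \<in> ball 0 \<epsilon> \<Longrightarrow> a * z \<in> ball 0 r \<and> g z = f (a * z)"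
proof -
  have f_even: "f (- z) = f z" if "z \<in> ball 0 r" for z
    using f(3)[of "- z" z] that by simp
  obtain F where F: "F holomorphic_on ball 0 (r ^ 2)" "\<And>z. z \<in> ball 0 r \<Longrightarrow> f z = F (z ^ 2)"
    using even_holomorphic_factor[OF f(1) f_even f(2)] by blast
  obtain G where G: "G holomorphic_on ball 0 (r ^ 2)" "\<And>z. z \<in> ball 0 r \<Longrightarrow> g z = G (z ^ 2)"
    using even_holomorphic_factor[OF g(1) g(3) f(2)] by blast
  have sqrt_ball: "csqrt s \<in> ball 0 r" if "s \<in> ball 0 (r ^ 2)" for s
  proof -
    have "norm (csqrt s) ^ 2 < r ^ 2"
      using that by (simp add: norm_power[symmetric])
    then show ?thesis
      using f(2) by (simp add: power2_less_imp_less)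
  qed
  have sqrt_mult: "\<kappa> * csqrt s \<in> ball 0 r" if "\<kappa> ^ 2 * s \<in> ball 0 (r ^ 2)" for s
  proof -
    have "norm (\<kappa> * csqrt s) ^ 2 = norm (\<kappa> ^ 2 * s)"
      by (simp add: norm_power[symmetric] power_mult_distrib)
    then have "norm (\<kappa> * csqrt s) ^ 2 < r ^ 2"
      using that by simp
    then show ?thesis
      using f(2) by (simp add: power2_less_imp_less)
  qed
  have F_csqrt: "F s = f (csqrt s)" and G_csqrt: "G s = g (csqrt s)" if "s \<in> ball 0 (r ^ 2)" for s
    using F(2)[OF sqrt_ball[OF that]] G(2)[OF sqrt_ball[OF that]] by simp_all
  have F_mult: "F (\<kappa> ^ 2 * s) = f (\<kappa> * csqrt s)" and G_mult: "G (\<kappa> ^ 2 * s) = g (\<kappa> * csqrt s)"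
    if "\<kappa> ^ 2 * s \<in> ball 0 (r ^ 2)" for s
    using F(2)[OF sqrt_mult[OF that]] G(2)[OF sqrt_mult[OF that]] by (simp_all add: power_mult_distrib)
  have F_inj: "inj_on F (ball 0 (r ^ 2))"
  proof (rule inj_onI)
    fix s t assume st: "s \<in> ball 0 (r ^ 2)" "t \<in> ball 0 (r ^ 2)" "F s = F t"
    then have "csqrt s = csqrt t \<or> csqrt s = - csqrt t"
      using f(3)[OF sqrt_ball sqrt_ball] F_csqrt by metis
    then show "s = t"
      by (metis power2_csqrt power2_minus)
  qed
  have rel': "\<forall>\<^sub>F s in cocountable. \<forall>u. s \<in> ball 0 (r ^ 2) \<longrightarrow> \<kappa> ^ 2 * s \<in> ball 0 (r ^ 2) \<longrightarrow>
      u \<in> ball 0 (r ^ 2) \<longrightarrow> \<kappa> ^ 2 * u \<in> ball 0 (r ^ 2) \<longrightarrow> G s = F u \<longrightarrow> G (\<kappa> ^ 2 * s) = F (\<kappa> ^ 2 * u)"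
  proof -
    have "\<forall>\<^sub>F s in cocountable. \<forall>u. csqrt s \<in> ball 0 r \<longrightarrow> \<kappa> * csqrt s \<in> ball 0 r \<longrightarrow> u \<in> ball 0 r \<longrightarrow> \<kappa> * u \<in> ball 0 r
      \<longrightarrow> g (csqrt s) = f u \<longrightarrow> g (\<kappa> * csqrt s) = f (\<kappa> * u)"
      by (rule cocountable_compose_inj[OF rel, of csqrt]) (metis injI power2_csqrt)
    then show ?thesis
    proof eventually_elim
      case (elim s)
      show ?case
      proof (intro allI impI)
        fix u assume u: "s \<in> ball 0 (r ^ 2)" "\<kappa> ^ 2 * s \<in> ball 0 (r ^ 2)" "u \<in> ball 0 (r ^ 2)"
          "\<kappa> ^ 2 * u \<in> ball 0 (r ^ 2)" "G s = F u"
        then have "g (csqrt s) = f (csqrt u)"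
          using F_csqrt G_csqrt by simp
        then have "g (\<kappa> * csqrt s) = f (\<kappa> * csqrt u)"
          using elim sqrt_ball[OF u(1)] sqrt_mult[OF u(2)] sqrt_ball[OF u(3)] sqrt_mult[OF u(4)] by blast
        then show "G (\<kappa> ^ 2 * s) = F (\<kappa> ^ 2 * u)"
          using F_mult[OF u(4)] G_mult[OF u(2)] by simp
      qed
    qed
  qed
  have "G 0 = F 0"
    using F(2)[of 0] G(2)[of 0] g(2) f(2) by simp
  moreover have "norm (\<kappa> ^ 2) > 1"
    using \<kappa> by (simp add: norm_power one_less_power)
  moreover have "r ^ 2 > 0"
    using f(2) by simp
  ultimately obtain a \<epsilon> where a: "\<epsilon> > 0" "\<And>s. s \<in> ball 0 \<epsilon> \<Longrightarrow> a * s \<in> ball 0 (r ^ 2) \<and> G s = F (a * s)"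
    using linear_lift[OF F(1) F_inj _ G(1) _ _ refl rel'] by metis
  define \<epsilon>' where "\<epsilon>' = min r (sqrt \<epsilon>)"
  show ?thesis
  proof (rule that[of \<epsilon>' "csqrt a"])
    show "\<epsilon>' > 0"
      using a(1) f(2) by (simp add: \<epsilon>'_def)
    fix z :: complex assume z: "z \<in> ball 0 \<epsilon>'"
    then have zr: "z \<in> ball 0 r"
      by (simp add: \<epsilon>'_def)
    have "norm z ^ 2 < sqrt \<epsilon> ^ 2"
      using z by (intro power_strict_mono) (auto simp: \<epsilon>'_def)
    then have "z ^ 2 \<in> ball 0 \<epsilon>"
      using a(1) by (simp add: norm_power)
    then have az: "a * z ^ 2 \<in> ball 0 (r ^ 2)" "G (z ^ 2) = F (a * z ^ 2)"
      using a(2) by blast+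
    have e: "a * z ^ 2 = (csqrt a * z) ^ 2"
      by (simp add: power_mult_distrib)
    have "norm (csqrt a * z) ^ 2 < r ^ 2"
      using az(1) unfolding e by (simp add: norm_power)
    then have "csqrt a * z \<in> ball 0 r"
      using f(2) by (simp add: power2_less_imp_less)
    then show "csqrt a * z \<in> ball 0 r \<and> g z = f (csqrt a * z)"
      using F(2) G(2)[OF zr] az(2) e by simp
  qed
qed

section \<open>Uniqueness of the uniformization\<close>

context uniformization
begin

text \<open>
  The value \<open>g(0)\<close>, at the centre of the linearization, becomes meaningful once removable
  singularities are filled in.
\<close>

lemma uniformizes_remove_sings: "uniformizes m B (remove_sings g) M"
proof -
  let ?h = "remove_sings g"
  have eq: "\<forall>\<^sub>F z in cocountable. ?h z = g z"
    by (rule eventually_cosparse_imp_cocountable[OF eventually_remove_sings_eq[OF mero]])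
  have m0: "of_nat m \<noteq> (0 :: complex)"
    using m_pos by simp
  have "\<forall>\<^sub>F z in cocountable. ?h (- 1 * z + 0) = g (- 1 * z + 0)"
    by (rule cocountable_affine[OF eq]) simp
  with eq even have "\<forall>\<^sub>F z in cocountable. ?h (- z) = ?h z"
    by eventually_elim simp
  moreover have "\<forall>\<^sub>F z in cocountable. ?h (of_nat m * z + 0) = g (of_nat m * z + 0)"
    by (rule cocountable_affine[OF eq m0])
  with eq mult have "\<forall>\<^sub>F z in cocountable. ?h (of_nat m * z) = rat_eval B (?h z)"
    by eventually_elim simp
  moreover have "\<exists>E. countable E \<and>
      (\<forall>z w. z \<notin> E \<longrightarrow> w \<notin> E \<longrightarrow> (?h z = ?h w \<longleftrightarrow> z - w \<in> M \<or> z + w \<in> M))"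
    using eq exceptional unfolding eventually_cocountable
    by (intro exI[of _ "exceptional \<union> {z. ?h z \<noteq> g z}"]) auto
  ultimately show ?thesis
    unfolding uniformizes_def
    using remove_sings_meromorphic[OF mero] M_zero M_diff M_countable by blast
qed

lemma punctured_disc:
  obtains r where "r > 0" "g holomorphic_on ball 0 r - {0}" "\<And>z. z \<in> ball 0 r - {0} \<Longrightarrow> g (- z) = g z"
proof -
  have "isolated_singularity_at g 0"
    using meromorphic_on_isolated_singularity mero meromorphic_on_subset by blast
  then obtain r where r: "r > 0" "g analytic_on ball 0 r - {0}"
    unfolding isolated_singularity_at_def by blast
  then have hol: "g holomorphic_on ball 0 r - {0}"
    using analytic_imp_holomorphic by blast
  have "g (- z) = g z" if "z \<in> ball 0 r - {0}" for z
  proof (rule continuous_eq_cocountable[OF _ _ _ _ that])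
    show "continuous_on (ball 0 r - {0}) (\<lambda>z. g (- z))"
      by (intro continuous_on_compose2[OF holomorphic_on_imp_continuous_on[OF hol]] continuous_intros) auto
    show "\<forall>\<^sub>F z in cocountable. z \<in> ball 0 r - {0} \<longrightarrow> g (- z) = g z"
      using even by eventually_elim simp
  qed (auto intro: holomorphic_on_imp_continuous_on[OF hol])
  then show ?thesis
    using that r(1) hol by blast
qed

end

locale lattes_uniformization = plane_lattice L + uniformization m "mult_ratfun m L" g M for L m g M +
  assumes m_ge: "m \<ge> 2" and nicely: "g nicely_meromorphic_on UNIV"
begin

lemma m_nz: "of_nat m \<noteq> (0 :: complex)"
  using m_pos by simp

lemma norm_m: "norm (of_nat m :: complex) > 1"
  using m_ge by simp

text \<open>
  The only way in which the rational function enters the uniqueness argument: where \<open>g\<close> and \<open>\<wp>\<close>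
  agree, so do their composites with multiplication by \<open>m\<close>, both being values of the same function.
\<close>

lemma mult_transfer:
  "\<forall>\<^sub>F z in cocountable. \<forall>u. u \<notin> L \<longrightarrow> g z = wp L u \<longrightarrow>
     of_nat m * u \<notin> L \<and> g (of_nat m * z) = wp L (of_nat m * u)"
proof -
  have "{u. of_nat m * u \<in> L} = (*) (1 / of_nat m) ` L"
    using m_nz by (auto simp: image_iff intro!: bexI[of _ "of_nat m * _"])
  then have "countable {u. of_nat m * u \<in> L}"
    using countable_lattice by simp
  then have "\<forall>\<^sub>F z in cocountable. \<forall>u\<in>{u. of_nat m * u \<in> L}. g z \<noteq> wp L u"
    by (rule cocountable_ball) (rule avoid)
  with mult show ?thesis
  proof eventually_elim
    case (elim z)
    show ?case
    proof (intro allI impI conjI)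
      fix u assume u: "u \<notin> L" "g z = wp L u"
      then show mu: "of_nat m * u \<notin> L"
        using elim(2) by blast
      then show "g (of_nat m * z) = wp L (of_nat m * u)"
        using elim(1) u(2) mult_ratfun(2)[OF m_pos mu] by simp
    qed
  qed
qed

text \<open>
  The previous lemma in the limit \<open>z \<rightarrow> 0\<close>. As \<open>\<wp>\<close> is open, there are general \<open>z\<close> near \<open>0\<close> and \<open>u\<close> near
  \<open>w\<close> with \<open>g(z) = \<wp>(u)\<close>, and then \<open>g(mz) = \<wp>(mu)\<close>. Here \<open>g(mz)\<close> is close to \<open>g(0)\<close>, which rules
  out both a pole of \<open>\<wp>\<close> at \<open>mw\<close> and a finite value other than \<open>g(0)\<close>.
\<close>

lemma centre_fixed:
  assumes cont: "isCont g 0" and w: "w \<notin> L" "wp L w = g 0"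
  shows "of_nat m * w \<notin> L \<and> wp L (of_nat m * w) = wp L w"
proof -
  have pairs: "\<exists>z u. norm z < \<epsilon> \<and> norm (u - w) < \<epsilon> \<and> of_nat m * u \<notin> L \<and>
      g (of_nat m * z) = wp L (of_nat m * u)" if \<epsilon>: "\<epsilon> > 0" for \<epsilon>
  proof -
    let ?U = "ball w \<epsilon> - L"
    have "\<not> wp L constant_on - L"
    proof
      assume "wp L constant_on - L"
      then obtain c where "\<And>z. z \<notin> L \<Longrightarrow> wp L z = c"
        by (auto simp: constant_on_def)
      then show False
        using wp_surj[of "c + 1"] by auto
    qed
    then have "open (wp L ` ?U)"
      using open_compl connected_compl closed_lattice
      by (intro open_mapping_thm[OF wp_holomorphic]) (auto intro: open_Diff)
    moreover have "g 0 \<in> wp L ` ?U"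
      using w \<epsilon> by (metis DiffI centre_in_ball imageI)
    ultimately have "\<forall>\<^sub>F z in nhds 0. g z \<in> wp L ` ?U"
      using cont by (auto simp: isCont_def tendsto_at_iff_tendsto_nhds topological_tendstoD)
    then obtain d where d: "d > 0" "\<And>z. dist z 0 < d \<Longrightarrow> g z \<in> wp L ` ?U"
      unfolding eventually_nhds_metric by blast
    have "ball (0::complex) (min d \<epsilon>) \<noteq> {}"
      using d(1) \<epsilon> by simp
    then obtain z where z: "z \<in> ball 0 (min d \<epsilon>)"
      "\<And>u. u \<notin> L \<Longrightarrow> g z = wp L u \<Longrightarrow> of_nat m * u \<notin> L \<and> g (of_nat m * z) = wp L (of_nat m * u)"
      using cocountable_exists_in_open[OF mult_transfer open_ball] by blast
    then obtain u where "u \<in> ?U" "g z = wp L u"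
      using d(2)[of z] by auto
    then show ?thesis
      using z by (intro exI[of _ z] exI[of _ u]) (auto simp: dist_norm norm_minus_commute)
  qed
  have m_pos': "real m > 0"
    using m_pos by simp
  have small: False
    if d: "d > 0" and e: "e > 0"
      and far: "\<And>v z. v \<notin> L \<Longrightarrow> norm (v - of_nat m * w) < d \<Longrightarrow> norm z < e \<Longrightarrow> g z \<noteq> wp L v" for d e
  proof -
    define \<epsilon> where "\<epsilon> = min d e / real m"
    have "\<epsilon> > 0"
      using d e m_pos' by (simp add: \<epsilon>_def)
    then obtain z u where zu: "norm z < \<epsilon>" "norm (u - w) < \<epsilon>" "of_nat m * u \<notin> L"
      "g (of_nat m * z) = wp L (of_nat m * u)"
      using pairs by blast
    have "norm (of_nat m * z) < e" "norm (of_nat m * (u - w)) < d"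
      using zu(1,2) m_pos' by (simp_all add: \<epsilon>_def norm_mult pos_less_divide_eq mult.commute)
    then have "norm (of_nat m * z) < e" "norm (of_nat m * u - of_nat m * w) < d"
      by (simp_all only: right_diff_distrib)
    then show False
      using far zu(3,4) by blast
  qed
  have lim_g: "(g \<longlongrightarrow> g 0) (nhds 0)"
    using cont by (simp add: isCont_def tendsto_at_iff_tendsto_nhds)
  have mw: "of_nat m * w \<notin> L"
  proof
    assume "of_nat m * w \<in> L"
    then have "filterlim (wp L) at_infinity (at (of_nat m * w))"
      using wp_pole is_pole_def by blast
    then have "\<forall>\<^sub>F v in at (of_nat m * w). norm (wp L v) \<ge> norm (g 0) + 1"
      by (simp add: filterlim_at_infinity[of "0"]) (metis add_nonneg_pos norm_ge_zero zero_less_one)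
    then obtain d where d: "d > 0"
      "\<And>v. v \<noteq> of_nat m * w \<Longrightarrow> dist v (of_nat m * w) < d \<Longrightarrow> norm (wp L v) \<ge> norm (g 0) + 1"
      unfolding eventually_at by blast
    have "\<forall>\<^sub>F z in nhds 0. norm (g z) < norm (g 0) + 1"
      by (rule order_tendstoD(2)[OF tendsto_norm[OF lim_g]]) simp
    then obtain e where e: "e > 0" "\<And>z. dist z 0 < e \<Longrightarrow> norm (g z) < norm (g 0) + 1"
      unfolding eventually_nhds_metric by blast
    show False
    proof (rule small[OF d(1) e(1)])
      fix v z :: complex assume vz: "v \<notin> L" "norm (v - of_nat m * w) < d" "norm z < e"
      then have "norm (wp L v) \<ge> norm (g 0) + 1"
        using d(2)[of v] \<open>of_nat m * w \<in> L\<close> by (auto simp: dist_norm)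
      moreover have "norm (g z) < norm (g 0) + 1"
        using e(2)[of z] vz(3) by simp
      ultimately show "g z \<noteq> wp L v"
        by auto
    qed
  qed
  moreover have "wp L (of_nat m * w) = g 0"
  proof (rule ccontr)
    assume ne: "wp L (of_nat m * w) \<noteq> g 0"
    define \<eta> where "\<eta> = dist (wp L (of_nat m * w)) (g 0) / 2"
    have \<eta>: "\<eta> > 0"
      using ne by (simp add: \<eta>_def)
    have "(wp L \<longlongrightarrow> wp L (of_nat m * w)) (nhds (of_nat m * w))"
      using wp_analytic_at[OF mw] analytic_at_imp_isCont
      by (simp add: isCont_def tendsto_at_iff_tendsto_nhds)
    then have "\<forall>\<^sub>F v in nhds (of_nat m * w). dist (wp L v) (wp L (of_nat m * w)) < \<eta>"
      using \<eta> tendstoD by blast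
    then obtain d where d: "d > 0"
      "\<And>v. dist v (of_nat m * w) < d \<Longrightarrow> dist (wp L v) (wp L (of_nat m * w)) < \<eta>"
      unfolding eventually_nhds_metric by blast
    have "\<forall>\<^sub>F z in nhds 0. dist (g z) (g 0) < \<eta>"
      using lim_g \<eta> tendstoD by blast
    then obtain e where e: "e > 0" "\<And>z. dist z 0 < e \<Longrightarrow> dist (g z) (g 0) < \<eta>"
      unfolding eventually_nhds_metric by blast
    show False
    proof (rule small[OF d(1) e(1)])
      fix v z :: complex assume vz: "v \<notin> L" "norm (v - of_nat m * w) < d" "norm z < e"
      then have "dist (wp L v) (wp L (of_nat m * w)) < \<eta>" "dist (g z) (g 0) < \<eta>"
        using d(2)[of v] e(2)[of z] by (simp_all add: dist_norm)
      then show "g z \<noteq> wp L v"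
        using dist_triangle[of "wp L (of_nat m * w)" "g 0" "wp L v"]
        by (auto simp: \<eta>_def dist_commute)
    qed
  qed
  ultimately show ?thesis
    using w(2) by simp
qed

lemma small_radius:
  assumes "c \<notin> L"
  obtains r where "r > 0" "\<And>u. norm u < r \<Longrightarrow> c + u \<notin> L"
proof -
  obtain r where "r > 0" "ball c r \<subseteq> - L"
    using assms open_compl open_contains_ball by (metis ComplI)
  then show ?thesis
    by (intro that[of r]) (auto simp: subset_iff dist_norm)
qed

lemma small_radius_0:
  obtains r where "r > 0" "\<And>u. norm u < r \<Longrightarrow> u \<in> L \<Longrightarrow> u = 0"
proof -
  obtain r where r: "r > 0" "L \<inter> ball 0 r = {0}"
    using wp_near_0 by metis
  show ?thesis
  proof (rule that[OF r(1)])
    fix u assume "norm u < r" "u \<in> L"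
    then have "u \<in> L \<inter> ball 0 r"
      by simp
    then show "u = 0"
      unfolding r(2) by simp
  qed
qed

text \<open>
  Here \<open>g(0) = \<infinity> = \<wp>(0)\<close>, so \<open>w = 0\<close>. The reciprocals of \<open>g\<close> and \<open>\<wp>\<close> are even holomorphic functions
  near \<open>0\<close>, and \<open>1/\<wp>\<close> separates points up to sign.
\<close>

lemma local_form_at_pole:
  assumes pole: "is_pole g 0"
  shows "\<exists>a \<epsilon>. \<epsilon> > 0 \<and> (\<forall>z\<in>ball 0 \<epsilon> - {0}. g z = wp L (a * z))"
proof -
  obtain r0 where r0: "r0 > 0" "g holomorphic_on ball 0 r0 - {0}"
    "\<And>z. z \<in> ball 0 r0 - {0} \<Longrightarrow> g (- z) = g z"
    by (rule punctured_disc) blast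
  obtain r1 where r1: "r1 > 0" "\<And>u. norm u < r1 \<Longrightarrow> u \<in> L \<Longrightarrow> u = 0"
    by (rule small_radius_0) blast
  have "\<forall>\<^sub>F z in at 0. g z \<noteq> 0" "\<forall>\<^sub>F z in at 0. wp L z \<noteq> 0"
    using non_zero_neighbour_pole pole wp_pole[OF zero_mem] by blast+
  then have "\<forall>\<^sub>F z in at 0. g z \<noteq> 0 \<and> wp L z \<noteq> 0"
    by (rule eventually_conj)
  then obtain r2 where r2: "r2 > 0" "\<And>z. z \<noteq> 0 \<Longrightarrow> dist z 0 < r2 \<Longrightarrow> g z \<noteq> 0 \<and> wp L z \<noteq> 0"
    unfolding eventually_at by blast
  (* Halving r1 keeps sums and differences of two points of the disc within distance r1 of 0. *)
  define r where "r = min r0 (min (r1 / 2) r2)"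
  have r: "r > 0" "r \<le> r0" "2 * r \<le> r1" "r \<le> r2"
    using r0 r1 r2 by (auto simp: r_def)
  define f1 where "f1 u = (if u = 0 then 0 else inverse (wp L u))" for u
  define g1 where "g1 z = (if z = 0 then 0 else inverse (g z))" for z
  have notL: "u \<notin> L" if "u \<in> ball 0 r - {0}" for u
    using r1(2)[of u] r that by auto
  have nz: "g z \<noteq> 0" "wp L z \<noteq> 0" if "z \<in> ball 0 r - {0}" for z
    using r2(2)[of z] r that by auto
  have f1: "f1 holomorphic_on ball 0 r"
    unfolding f1_def using notL nz
    by (intro is_pole_inverse_holomorphic wp_pole holomorphic_on_subset[OF wp_holomorphic]) auto
  have g1: "g1 holomorphic_on ball 0 r"
    unfolding g1_def using nz r(2)
    by (intro is_pole_inverse_holomorphic pole holomorphic_on_subset[OF r0(2)]) auto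
  have g1_even: "g1 (- z) = g1 z" if "z \<in> ball 0 r" for z
    using r0(3)[of z] that r(2) by (auto simp: g1_def)
  have f1_eq: "f1 u = f1 v \<longleftrightarrow> u = v \<or> u = - v" if uv: "u \<in> ball 0 r" "v \<in> ball 0 r" for u v
  proof (cases "u = 0 \<or> v = 0")
    case True
    then show ?thesis
      using nz(2)[of u] nz(2)[of v] uv by (auto simp: f1_def)
  next
    case False
    have "norm (u - v) < r1" "norm (u + v) < r1"
      using norm_triangle_ineq4[of u v] norm_triangle_ineq[of u v] uv r(3) by simp_all
    then have "u - v \<in> L \<longleftrightarrow> u = v" "u + v \<in> L \<longleftrightarrow> u = - v"
      using r1(2)[of "u - v"] r1(2)[of "u + v"] by (auto simp: add_eq_0_iff2)
    then show ?thesis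
      using False wp_eq_iff[OF notL notL, of u v] uv by (simp add: f1_def)
  qed
  have rel: "\<forall>\<^sub>F z in cocountable. \<forall>u. z \<in> ball 0 r \<longrightarrow> of_nat m * z \<in> ball 0 r \<longrightarrow> u \<in> ball 0 r \<longrightarrow>
      of_nat m * u \<in> ball 0 r \<longrightarrow> g1 z = f1 u \<longrightarrow> g1 (of_nat m * z) = f1 (of_nat m * u)"
    using mult_transfer cocountable_notin[of "{0}", simplified]
  proof eventually_elim
    case (elim z)
    show ?case
    proof (intro allI impI)
      fix u assume u: "z \<in> ball 0 r" "of_nat m * z \<in> ball 0 r" "u \<in> ball 0 r"
        "of_nat m * u \<in> ball 0 r" "g1 z = f1 u"
      then have "u \<noteq> 0"
        using elim(2) nz(1)[of z] by (auto simp: g1_def f1_def)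
      then show "g1 (of_nat m * z) = f1 (of_nat m * u)"
        using elim u notL[of u] m_nz by (auto simp: g1_def f1_def)
    qed
  qed
  have "g1 0 = f1 0"
    by (simp add: f1_def g1_def)
  then obtain a \<epsilon> where a: "\<epsilon> > 0" "\<And>z. z \<in> ball 0 \<epsilon> \<Longrightarrow> a * z \<in> ball 0 r \<and> g1 z = f1 (a * z)"
    using linear_lift_even[OF f1 r(1) f1_eq g1 _ g1_even norm_m rel] by metis
  define \<epsilon>' where "\<epsilon>' = min \<epsilon> r"
  have "g z = wp L (a * z)" if z: "z \<in> ball 0 \<epsilon>' - {0}" for z
  proof -
    have *: "inverse (g z) = f1 (a * z)"
      using a(2)[of z] z by (auto simp: \<epsilon>'_def g1_def)
    moreover have "g z \<noteq> 0"
      using nz(1)[of z] z by (auto simp: \<epsilon>'_def)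
    ultimately show ?thesis
      by (auto simp: f1_def split: if_splits)
  qed
  moreover have "\<epsilon>' > 0"
    using a(1) r(1) by (simp add: \<epsilon>'_def)
  ultimately show ?thesis
    by blast
qed

text \<open>
  With \<open>\<wp>(w) = g(0)\<close>, the points \<open>mw\<close> and \<open>w\<close> agree modulo \<open>L\<close> up to sign. If \<open>2w \<in> L\<close> then
  \<open>\<wp>(w + u)\<close> is even in \<open>u\<close> and separates points near \<open>0\<close> up to sign. Otherwise it is injective near
  \<open>0\<close>, and multiplication by \<open>m\<close> acts on the lift by \<open>m\<close> or \<open>-m\<close> according to the sign.
\<close>

lemma local_form_at_finite_value:
  assumes no_pole: "\<not> is_pole g 0"
  shows "\<exists>w a \<epsilon>. \<epsilon> > 0 \<and> (\<forall>z\<in>ball 0 \<epsilon>. g z = wp L (w + a * z))"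
proof -
  have an: "g analytic_on {0}"
    using nicely_meromorphic_on_imp_analytic_at[OF nicely _ no_pole] by simp
  then have cont: "isCont g 0"
    by (rule analytic_at_imp_isCont)
  obtain w where w: "w \<notin> L" "wp L w = g 0"
    using wp_surj by blast
  have mw: "of_nat m * w \<notin> L" "of_nat m * w - w \<in> L \<or> of_nat m * w + w \<in> L"
    using centre_fixed[OF cont w] wp_eq_iff[OF _ w(1)] by blast+
  obtain r0 where r0: "r0 > 0" "g holomorphic_on ball 0 r0 - {0}"
    "\<And>z. z \<in> ball 0 r0 - {0} \<Longrightarrow> g (- z) = g z"
    by (rule punctured_disc) blast
  have "g holomorphic_on ball 0 r0"
  proof (rule no_isolated_singularity'[of "{0}"])
    show "(g \<longlongrightarrow> g z) (at z within ball 0 r0)" if "z \<in> {0}" for z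
      using cont that by (auto simp: isCont_def intro: tendsto_within_subset)
  qed (use r0(2) in auto)
  note g_hol = this
  obtain r1 where r1: "r1 > 0" "\<And>u. norm u < r1 \<Longrightarrow> u \<in> L \<Longrightarrow> u = 0"
    by (rule small_radius_0) blast
  obtain r2 where r2: "r2 > 0" "\<And>u. norm u < r2 \<Longrightarrow> w + u \<notin> L"
    by (rule small_radius[OF w(1)]) blast
  define f1 where "f1 u = wp L (w + u)" for u
  have f1_0: "g 0 = f1 0"
    using w(2) by (simp add: f1_def)
  have f1_hol: "f1 holomorphic_on ball 0 r" if "r \<le> r2" for r
  proof -
    have "(\<lambda>u. w + u) ` ball 0 r \<subseteq> - L"
      using r2(2) that by (intro image_subsetI) simp
    then show ?thesis
      unfolding f1_def
      by (intro holomorphic_on_compose_gen[OF _ wp_holomorphic, unfolded o_def] holomorphic_intros)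
  qed
  have f1_eq: "f1 u = f1 v \<longleftrightarrow> u = v \<or> 2 * w + (u + v) \<in> L"
    if "norm u < r" "norm v < r" "r \<le> r2" "2 * r \<le> r1" for u v r
  proof -
    have "norm (u - v) < r1"
      using norm_triangle_ineq4[of u v] that by simp
    then have "u - v \<in> L \<longleftrightarrow> u = v"
      using r1(2)[of "u - v"] by auto
    then show ?thesis
      using wp_eq_iff[OF r2(2) r2(2), of u v] that by (simp add: f1_def algebra_simps)
  qed
  show ?thesis
  proof (cases "2 * w \<in> L")
    case True
    define r where "r = min r0 (min (r1 / 2) r2)"
    have r: "r > 0" "r \<le> r0" "2 * r \<le> r1" "r \<le> r2"
      using r0 r1 r2 by (auto simp: r_def)
    have eq: "f1 u = f1 v \<longleftrightarrow> u = v \<or> u = - v" if uv: "u \<in> ball 0 r" "v \<in> ball 0 r" for u v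
    proof -
      have "norm (u + v) < r1"
        using norm_triangle_ineq[of u v] uv r(3) by simp
      then have "2 * w + (u + v) \<in> L \<longleftrightarrow> u = - v"
        using r1(2)[of "u + v"] add_mem_cancel[OF True, of "u + v"]
        by (auto simp: add.commute add_eq_0_iff2)
      then show ?thesis
        using f1_eq[of u r v] uv r by simp
    qed
    have mw': "of_nat m * w - w \<in> L"
      using mw(2) diff_mem[OF _ True, of "of_nat m * w + w"] by (auto simp: algebra_simps)
    have rel: "\<forall>\<^sub>F z in cocountable. \<forall>u. z \<in> ball 0 r \<longrightarrow> of_nat m * z \<in> ball 0 r \<longrightarrow> u \<in> ball 0 r \<longrightarrow>
        of_nat m * u \<in> ball 0 r \<longrightarrow> g z = f1 u \<longrightarrow> g (of_nat m * z) = f1 (of_nat m * u)"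
      using mult_transfer
    proof eventually_elim
      case (elim z)
      show ?case
      proof (intro allI impI)
        fix u assume u: "u \<in> ball 0 r" "g z = f1 u"
        then have "g (of_nat m * z) = wp L (of_nat m * (w + u))"
          using elim r2(2)[of u] r(4) by (simp add: f1_def)
        also have "of_nat m * (w + u) = w + of_nat m * u + (of_nat m * w - w)"
          by (simp add: algebra_simps)
        also have "wp L \<dots> = f1 (of_nat m * u)"
          using wp_add_period[OF mw', of "w + of_nat m * u"] by (simp only: f1_def)
        finally show "g (of_nat m * z) = f1 (of_nat m * u)" .
      qed
    qed
    have even: "g (- z) = g z" if "z \<in> ball 0 r" for z
      using r0(3)[of z] that r(2) by (cases "z = 0") auto
    obtain a \<epsilon> where "\<epsilon> > 0" "\<And>z. z \<in> ball 0 \<epsilon> \<Longrightarrow> a * z \<in> ball 0 r \<and> g z = f1 (a * z)"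
      using linear_lift_even[OF f1_hol[OF r(4)] r(1) eq
          holomorphic_on_subset[OF g_hol subset_ball[OF r(2)]] f1_0 even norm_m rel] by metis
    then show ?thesis
      unfolding f1_def by blast
  next
    case False
    obtain r3 where r3: "r3 > 0" "\<And>u. norm u < r3 \<Longrightarrow> 2 * w + u \<notin> L"
      by (rule small_radius[OF False]) blast
    define r where "r = min r0 (min (r1 / 2) (min r2 (r3 / 2)))"
    have r: "r > 0" "r \<le> r0" "2 * r \<le> r1" "r \<le> r2" "2 * r \<le> r3"
      using r0 r1 r2 r3 by (auto simp: r_def)
    have inj: "inj_on f1 (ball 0 r)"
    proof (rule inj_onI)
      fix u v assume uv: "u \<in> ball 0 r" "v \<in> ball 0 r" "f1 u = f1 v"
      have "norm (u + v) < r3"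
        using norm_triangle_ineq[of u v] uv r(5) by simp
      then show "u = v"
        using f1_eq[of u r v] uv r r3(2) by simp
    qed
    (* The sign ambiguity of the centre becomes the sign of the multiplier. *)
    obtain \<mu> where \<mu>: "norm \<mu> = norm (of_nat m :: complex)"
      "\<And>u. wp L (of_nat m * (w + u)) = f1 (\<mu> * u)"
    proof (cases "of_nat m * w - w \<in> L")
      case True
      have "wp L (of_nat m * (w + u)) = f1 (of_nat m * u)" for u
        using wp_add_period[OF True, of "w + of_nat m * u"] by (simp add: f1_def distrib_left add.commute)
      then show ?thesis
        using that[of "of_nat m"] by simp
    next
      case False
      then have "of_nat m * w + w \<in> L"
        using mw(2) by blast
      then have "wp L (of_nat m * (w + u)) = wp L (- (w + (- of_nat m) * u))" for u
        using wp_add_period[of "of_nat m * w + w" "- (w + (- of_nat m) * u)"] by (simp add: algebra_simps)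
      then have "wp L (of_nat m * (w + u)) = f1 (- of_nat m * u)" for u
        by (simp only: wp_minus f1_def)
      then show ?thesis
        using that[of "- of_nat m"] by simp
    qed
    have rel: "\<forall>\<^sub>F z in cocountable. \<forall>u. z \<in> ball 0 r \<longrightarrow> of_nat m * z \<in> ball 0 r \<longrightarrow> u \<in> ball 0 r \<longrightarrow>
        \<mu> * u \<in> ball 0 r \<longrightarrow> g z = f1 u \<longrightarrow> g (of_nat m * z) = f1 (\<mu> * u)"
      using mult_transfer
    proof eventually_elim
      case (elim z)
      show ?case
      proof (intro allI impI)
        fix u assume u: "u \<in> ball 0 r" "g z = f1 u"
        then have "g (of_nat m * z) = wp L (of_nat m * (w + u))"
          using elim r2(2)[of u] r(4) by (simp add: f1_def)
        then show "g (of_nat m * z) = f1 (\<mu> * u)"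
          by (simp only: \<mu>(2))
      qed
    qed
    obtain a \<epsilon> where "\<epsilon> > 0" "\<And>z. z \<in> ball 0 \<epsilon> \<Longrightarrow> a * z \<in> ball 0 r \<and> g z = f1 (a * z)"
      using linear_lift[OF f1_hol[OF r(4)] inj r(1)
          holomorphic_on_subset[OF g_hol subset_ball[OF r(2)]] f1_0 norm_m \<mu>(1)[symmetric] rel] by metis
    then show ?thesis
      unfolding f1_def by blast
  qed
qed

text \<open>
  The local form extends to \<open>g(z) = \<wp>(w + az)\<close> at general points of the plane by the identity theorem.
  Comparing the periods of both sides determines \<open>M\<close>.
\<close>

theorem homothetic: "\<exists>a. a \<noteq> 0 \<and> (\<forall>t. t \<in> M \<longleftrightarrow> a * t \<in> L)"
proof -
  obtain w a \<epsilon> where \<epsilon>: "\<epsilon> > 0" "\<And>z. z \<in> ball 0 \<epsilon> - {0} \<Longrightarrow> g z = wp L (a * z + w)"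
  proof (cases "is_pole g 0")
    case True
    then show ?thesis
      using local_form_at_pole that[where w = 0] by fastforce
  next
    case False
    then show ?thesis
      using local_form_at_finite_value that by (metis DiffD1 add.commute)
  qed
  have ne: "ball (0::complex) \<epsilon> - {0} \<noteq> {}"
  proof -
    have "of_real (\<epsilon> / 2) \<in> ball (0::complex) \<epsilon> - {0}"
      using \<epsilon>(1) by simp
    then show ?thesis
      by blast
  qed
  have eq: "\<forall>\<^sub>F z in cocountable. g z = wp L (a * z + w)"
    by (rule meromorphic_eq_on_open_imp_eq[OF mero meromorphic_on_affine[OF wp_meromorphic] _ ne])
      (use \<epsilon>(2) in \<open>auto intro: always_eventually\<close>)
  have a0: "a \<noteq> 0"
  proof
    assume a: "a = 0"
    have "\<forall>\<^sub>F z in cocountable. False"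
      using eq avoid[of "wp L w"] by eventually_elim (simp add: a)
    then show False by simp
  qed
  have shift: "\<forall>\<^sub>F z in cocountable. g (z + t) = wp L (a * z + w + a * t)" for t
    using cocountable_affine[OF eq one_neq_zero, of t]
    by eventually_elim (simp add: algebra_simps)
  have fibre: "\<forall>\<^sub>F z in cocountable. g (z + t) = g z \<longleftrightarrow> t \<in> M" for t
    using generic_affine_notin[OF exceptional(1) one_neq_zero, of 0]
      generic_affine_notin[OF exceptional(1) one_neq_zero, of t]
      generic_affine_notin[OF M_countable, of 2 t, simplified]
  proof eventually_elim
    case (elim z)
    then show ?case
      using exceptional(2)[of "z + t" z] by (simp add: algebra_simps)
  qed
  have "t \<in> M \<longleftrightarrow> a * t \<in> L" for t
  proof
    assume t: "t \<in> M"
    have "\<forall>\<^sub>F z in cocountable. wp L (a * z + w + a * t) = wp L (a * z + w)"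
      using shift[of t] eq fibre[of t] by eventually_elim (use t in simp)
    then have "\<forall>\<^sub>F y in cocountable. wp L (a * (1 / a * y + (- w / a)) + w + a * t) = wp L (a * (1 / a * y + (- w / a)) + w)"
      by (rule cocountable_affine) (use a0 in simp)
    then have "\<forall>\<^sub>F y in cocountable. wp L (y + a * t) = wp L y"
      using a0 by (simp add: algebra_simps)
    then show "a * t \<in> L"
      by (rule wp_period_mem)
  next
    assume t: "a * t \<in> L"
    have "\<forall>\<^sub>F z in cocountable. t \<in> M"
      using shift[of t] eq fibre[of t] by eventually_elim (use wp_add_period[OF t] in simp)
    then show "t \<in> M"
      by simp
  qed
  then show ?thesis
    using a0 by blast
qed

end

section \<open>Mutual semiconjugacy without equivalence\<close>

theorem theorem4p1:
  fixes L L' :: "complex set" and m n :: nat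
  assumes "lattice2 L" and "\<not> has_CM L"
    and "prime n" and "prime m" and "n \<noteq> m"
    and "lattice2 L'" and "L \<subset> L'" and "L' \<subset> lattice_div L n"
  shows "mutually_semiconjugate (mult_ratfun m L') (mult_ratfun m L) \<and>
         \<not> rat_equiv (mult_ratfun m L') (mult_ratfun m L)"
proof
  interpret L: plane_lattice L
    using assms(1) by unfold_locales
  interpret L': plane_lattice L'
    using assms(6) by unfold_locales
  have m: "m > 0" "m \<ge> 2" and n: "n > 0"
    using assms(3,4) prime_gt_0_nat prime_ge_2_nat by blast+
  have div_iff: "x \<in> lattice_div L n \<longleftrightarrow> of_nat n * x \<in> L" for x
    using n by (auto simp: lattice_div_def image_iff field_simps)
  have nL': "of_nat n * x \<in> L" if "x \<in> L'" for x
    using that assms(8) div_iff by blast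
  show "mutually_semiconjugate (mult_ratfun m L') (mult_ratfun m L)"
    unfolding mutually_semiconjugate_def
  proof
    show "semiconjugate_to (mult_ratfun m L') (mult_ratfun m L)"
      by (rule semiconjugate_if_isogenous[where k = "of_nat n", OF L'.plane_lattice_axioms L.plane_lattice_axioms])
        (use n m nL' in auto)
    show "semiconjugate_to (mult_ratfun m L) (mult_ratfun m L')"
      by (rule semiconjugate_if_isogenous[where k = 1, OF L.plane_lattice_axioms L'.plane_lattice_axioms])
        (use m assms(7) in auto)
  qed
  show "\<not> rat_equiv (mult_ratfun m L') (mult_ratfun m L)"
  proof
    assume "rat_equiv (mult_ratfun m L') (mult_ratfun m L)"
    then obtain g M where gM: "uniformizes m (mult_ratfun m L) g M" "L' \<subseteq> M"
      and power: "\<And>t. t \<in> M \<Longrightarrow> \<exists>j. of_nat (m ^ j) * t \<in> L'"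
      using rat_equiv_uniformizes[OF _ L'.wp_uniformizes[OF m(1)] m(1)] by blast
    interpret U: uniformization m "mult_ratfun m L" g M
      using gM(1) m(1) by unfold_locales
    interpret lattes_uniformization L m "remove_sings g" M
      using U.uniformizes_remove_sings m remove_sings_nicely_meromorphic[OF U.mero] by unfold_locales
    obtain a where a: "a \<noteq> 0" "\<And>t. t \<in> M \<longleftrightarrow> a * t \<in> L"
      using homothetic by blast
    have "(*) a ` L \<subseteq> L"
      using a(2) gM(2) assms(7) by blast
    then have "a \<in> \<int>"
      using assms(2) unfolding has_CM_def by blast
    then obtain k where k: "a = of_int k"
      by (auto elim: Ints_cases)
    have bezout: "x \<in> N" if N: "plane_lattice N" and co: "coprime p q"
        and x: "of_int p * x \<in> N" "of_int q * x \<in> N" for N x and p q :: int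
    proof -
      interpret N: plane_lattice N
        by (rule N)
      obtain u v where "u * p + v * q = 1"
        using bezout_int[of p q] co by auto
      then have "of_int (u * p + v * q) = (1 :: complex)"
        by simp
      then have "x = of_int u * (of_int p * x) + of_int v * (of_int q * x)"
        by (simp add: algebra_simps) (metis distrib_left mult.commute mult.left_commute mult.right_neutral)
      then show ?thesis
        using N.add_mem N.of_int_mult_mem x by metis
    qed
    show False
    proof (cases "int n dvd k")
      case True
      then obtain k' where k': "k = int n * k'"
        by blast
      have "lattice_div L n \<subseteq> L'"
      proof
        fix x assume "x \<in> lattice_div L n"
        then have nx: "of_nat n * x \<in> L"
          by (simp add: div_iff)
        then have "of_int k' * (of_nat n * x) \<in> L"
          by (rule L.of_int_mult_mem)
        then have "x \<in> M"
          using a(2)[of x] by (simp add: k k' mult_ac)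
        then obtain j where j: "of_nat (m ^ j) * x \<in> L'"
          using power by blast
        have "coprime n m"
          using assms(3-5) primes_coprime by blast
        then have "coprime (int n) (int (m ^ j))"
          by simp
        then show "x \<in> L'"
          by (rule bezout[OF L'.plane_lattice_axioms]) (use nx j assms(7) in auto)
      qed
      then show False
        using assms(8) by blast
    next
      case False
      then have "coprime (int n) k"
        using assms(3) by (simp add: prime_imp_coprime)
      have "L' \<subseteq> L"
      proof
        fix x assume x: "x \<in> L'"
        show "x \<in> L"
          by (rule bezout[OF L.plane_lattice_axioms \<open>coprime (int n) k\<close>])
            (use nL'[OF x] a(2)[of x] gM(2) x k in auto)
      qed
      then show False
        using assms(7) by blast
    qed
  qed
qed

end
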